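(* Every fan graph $F_n$ ($n\ge 2$) satisfies $sn(F_n)=2$, and every maximal outerplanar graph $G$ of order at least $3$ satisfies $sn(G)=2$.
   Context: Graphs are finite, undirected and simple. The fan graph $F_n$, $n\ge 2$, is obtained from a path $P_n=v_1v_2\cdots v_n$ by joining a new vertex $u$ to every vertex of $P_n$. A maximal outerplanar graph is an outerplanar graph to which no edge between nonadjacent vertices can be added while preserving outerplanarity. Let $G=(V,E)$ be a connected graph with chromatic number $\chi(G)=k\ge 2$. For $S\subset V$, a partial coloring on $G[S]$ is a proper coloring $\mathscr C_0$ of the induced subgraph $G[S]$ with colors from $\{1,\dots,k\}$ (not all colors need be used). It is a Sudoku coloring of $G$ if there is exactly one proper $k$-coloring $V\to\{1,\dots,k\}$ of $G$ whose restriction to $S$ is $\mathscr C_0$. The Sudoku number $sn(G)$ is the smallest $|S|$ such that $G[S]$ admits a Sudoku coloring of $G$. *)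

theory Defs
  imports "HOL-Analysis.Analysis" "Graph_Theory.Digraph_Component"
begin

text \<open>
  A finite simple undirected graph is a \<^locale>\<open>pair_graph\<close>: every edge \<open>uv\<close> is present as the
  two arcs \<open>(u, v)\<close> and \<open>(v, u)\<close>. The notions on colorings are stated for
  arbitrary digraphs, so that they also apply to the induced subgraph \<open>G \<restriction> S\<close>.
\<close>

text \<open>
  Colorings are extensional functions (undefined outside the vertex set), so that
  uniqueness of a coloring means uniqueness as a function on the vertex set.
\<close>

definition proper_coloring :: "('a, 'b) pre_digraph \<Rightarrow> nat \<Rightarrow> ('a \<Rightarrow> nat) \<Rightarrow> bool" where
  "proper_coloring G k c \<longleftrightarrow>
     c \<in> verts G \<rightarrow>\<^sub>E {1..k} \<and> (\<forall>e\<in>arcs G. c (tail G e) \<noteq> c (head G e))"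

definition chromatic_number :: "('a, 'b) pre_digraph \<Rightarrow> nat" where
  "chromatic_number G = (LEAST k. \<exists>c. proper_coloring G k c)"

definition partial_coloring :: "('a, 'b) pre_digraph \<Rightarrow> 'a set \<Rightarrow> ('a \<Rightarrow> nat) \<Rightarrow> bool" where
  "partial_coloring G S c0 \<longleftrightarrow>
     S \<subseteq> verts G \<and> proper_coloring (G \<restriction> S) (chromatic_number G) c0"

definition sudoku_coloring :: "('a, 'b) pre_digraph \<Rightarrow> 'a set \<Rightarrow> ('a \<Rightarrow> nat) \<Rightarrow> bool" where
  "sudoku_coloring G S c0 \<longleftrightarrow>
     partial_coloring G S c0 \<and>
     (\<exists>!c. proper_coloring G (chromatic_number G) c \<and> restrict c S = c0)"

text \<open>
  Usually considered only for connected graphs of chromatic number at least 2. For any finite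
  graph without loops the minimum is over a nonempty set, since \<open>S = verts G\<close> qualifies.
\<close>

definition sudoku_number :: "('a, 'b) pre_digraph \<Rightarrow> nat" where
  "sudoku_number G = (LEAST m. \<exists>S c0. sudoku_coloring G S c0 \<and> card S = m)"

text \<open>The hub \<open>u\<close> is \<open>0\<close>, and the path vertices \<open>v\<^sub>1, \<dots>, v\<^sub>n\<close> are \<open>1, \<dots>, n\<close>.\<close>

definition fan_graph :: "nat \<Rightarrow> nat pair_pre_digraph" where
  "fan_graph n =
     (let E = {(i, Suc i) | i. 1 \<le> i \<and> i < n} \<union> {(0, i) | i. 1 \<le> i \<and> i \<le> n}
      in \<lparr> pverts = {0..n}, parcs = E \<union> E\<inverse> \<rparr>)"

text \<open>
  Vertex \<open>v\<close> is drawn as the point \<open>p v\<close>, and the edge \<open>uv\<close> as the Jordan arc \<open>\<gamma> (u, v)\<close>, whose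
  reverse is \<open>\<gamma> (v, u)\<close>. An edge passes through no vertices other than its ends,
  and different edges meet only in vertices, hence only in common ends.
\<close>

definition plane_drawing ::
  "'a pair_pre_digraph \<Rightarrow> ('a \<Rightarrow> complex) \<Rightarrow> ('a \<times> 'a \<Rightarrow> real \<Rightarrow> complex) \<Rightarrow> bool" where
  "plane_drawing G p \<gamma> \<longleftrightarrow>
     inj_on p (pverts G) \<and>
     (\<forall>(u, v)\<in>parcs G.
        arc (\<gamma> (u, v)) \<and> pathstart (\<gamma> (u, v)) = p u \<and> pathfinish (\<gamma> (u, v)) = p v \<and>
        \<gamma> (v, u) = reversepath (\<gamma> (u, v)) \<and>
        path_image (\<gamma> (u, v)) \<inter> p ` pverts G = {p u, p v}) \<and>
     (\<forall>(u, v)\<in>parcs G. \<forall>(x, y)\<in>parcs G. {u, v} \<noteq> {x, y} \<longrightarrow>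
        path_image (\<gamma> (u, v)) \<inter> path_image (\<gamma> (x, y)) \<subseteq> p ` pverts G)"

definition drawn_set ::
  "'a pair_pre_digraph \<Rightarrow> ('a \<Rightarrow> complex) \<Rightarrow> ('a \<times> 'a \<Rightarrow> real \<Rightarrow> complex) \<Rightarrow> complex set" where
  "drawn_set G p \<gamma> = p ` pverts G \<union> (\<Union>e\<in>parcs G. path_image (\<gamma> e))"

text \<open>
  The drawn set of a finite graph is compact, so its \<open>outside\<close> is the unique unbounded face.
\<close>

definition outerplanar :: "'a pair_pre_digraph \<Rightarrow> bool" where
  "outerplanar G \<longleftrightarrow>
     (\<exists>p \<gamma>. plane_drawing G p \<gamma> \<and> p ` pverts G \<subseteq> frontier (outside (drawn_set G p \<gamma>)))"

definition maximal_outerplanar :: "'a pair_pre_digraph \<Rightarrow> bool" where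
  "maximal_outerplanar G \<longleftrightarrow>
     outerplanar G \<and>
     (\<forall>u\<in>pverts G. \<forall>v\<in>pverts G. u \<noteq> v \<and> (u, v) \<notin> parcs G \<longrightarrow>
        \<not> outerplanar (G\<lparr>parcs := parcs G \<union> {(u, v), (v, u)}\<rparr>))"

lemma pair_graph_fan_graph: "pair_graph (fan_graph n)"
proof
  have "parcs (fan_graph n) \<subseteq> {0..n} \<times> {0..n}"
    by (auto simp: fan_graph_def Let_def)
  then show "finite (parcs (fan_graph n))"
    by (rule finite_subset) simp
qed (auto simp: fan_graph_def Let_def symmetric_def sym_def)

end

theory Submission
  imports Defs
begin

hide_const (open) Digraph_Component.connected

text \<open>
  In a theta curve in the plane one of the three arcs runs inside the cycle formed by the other two.
  Hence an outerplane graph has no three independent paths of length at least two between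
  the same two vertices, and no cycle with two crossing chords. By a longest cycle argument and
  induction along cut vertices, the vertices of a graph without these two configurations can be
  ordered such that no two edges cross. Conversely, such an order yields an outerplane drawing
  with the vertices on a parabola and the edges as chords. So a maximal outerplanar graph is a
  triangulated polygon, combinatorially. A triangulated polygon has chromatic number 3, and the
  colors of the two ends of an edge determine a 3-coloring, triangle by triangle. If at most one
  vertex is colored, then two colors can still be exchanged.
\<close>

section \<open>Theta curves in the plane\<close>

text \<open>\<open>outerplanar\<close> speaks of arbitrary Jordan arcs, and maximality negates it
  for the enlarged graph. So drawings and vertex orders have to be translated in both directions: a
  drawing yields an order, and if no edge were interleaved with a missing pair in that order, the
  same order would yield a drawing of the enlarged graph. Hence every missing pair is interleaved
  with an edge, and this is all that the triangulation takes from maximality.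

  The two forbidden configurations are tailored to what the topology gives cheaply. A path with an
  inner vertex that meets a cycle only in its ends cannot run inside this cycle, since the inner
  vertex would leave the outer face. Thus three such paths cannot coexist, whereas a single edge in
  place of the third one is forced inside.

  Fans need no drawing: with the hub placed before the path they satisfy the same combinatorial
  conditions. For the lower bound, a triangle shows that the two colors different from a prescribed
  one really occur, so that their exchange gives another coloring.\<close>

lemma two_arcs_Jordan:
  fixes c d :: "real \<Rightarrow> complex"
  assumes "arc c" "pathstart c = a" "pathfinish c = b"
    and "arc d" "pathstart d = a" "pathfinish d = b"
    and "path_image c \<inter> path_image d = {a, b}"
  shows "inside (path_image c \<union> path_image d) \<noteq> {}"
    and "connected (inside (path_image c \<union> path_image d))"
    and "frontier (inside (path_image c \<union> path_image d)) = path_image c \<union> path_image d"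
    and "connected (outside (path_image c \<union> path_image d))"
proof -
  let ?l = "c +++ reversepath d"
  have "simple_path ?l"
    using assms by (auto simp: simple_path_join_loop_eq arc_simple_path simple_path_reversepath)
  moreover have "pathfinish ?l = pathstart ?l"
    using assms by simp
  moreover have "path_image ?l = path_image c \<union> path_image d"
    using assms by (simp add: path_image_join)
  ultimately show "inside (path_image c \<union> path_image d) \<noteq> {}"
    "connected (inside (path_image c \<union> path_image d))"
    "frontier (inside (path_image c \<union> path_image d)) = path_image c \<union> path_image d"
    "connected (outside (path_image c \<union> path_image d))"
    using Jordan_inside_outside[of ?l] by auto
qed

lemma connected_subset_inside:
  assumes "connected T" "T \<inter> S = {}" "T \<inter> inside S \<noteq> {}"
  shows "T \<subseteq> inside S"
  using inside_outside_intersect_connected[OF assms(1), of S] assms inside_Un_outside[of S] by blast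

text \<open>
  Otherwise the insides of the three cycles and the unbounded face would be four different
  faces of the theta curve, which contradicts Janiszewski's theorem.
\<close>

lemma theta_curve_inside:
  fixes c1 c2 c3 :: "real \<Rightarrow> complex"
  assumes c1: "arc c1" "pathstart c1 = a" "pathfinish c1 = b"
    and c2: "arc c2" "pathstart c2 = a" "pathfinish c2 = b"
    and c3: "arc c3" "pathstart c3 = a" "pathfinish c3 = b"
    and i12: "path_image c1 \<inter> path_image c2 = {a, b}"
    and i13: "path_image c1 \<inter> path_image c3 = {a, b}"
    and i23: "path_image c2 \<inter> path_image c3 = {a, b}"
  shows "path_image c1 \<inter> inside (path_image c2 \<union> path_image c3) \<noteq> {} \<or>
    path_image c2 \<inter> inside (path_image c1 \<union> path_image c3) \<noteq> {} \<or>
    path_image c3 \<inter> inside (path_image c1 \<union> path_image c2) \<noteq> {}"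
proof (rule ccontr)
  let ?P1 = "path_image c1" and ?P2 = "path_image c2" and ?P3 = "path_image c3"
  assume "\<not> ?thesis"
  then have n: "?P1 \<inter> inside (?P2 \<union> ?P3) = {}" "?P2 \<inter> inside (?P1 \<union> ?P3) = {}"
    "?P3 \<inter> inside (?P1 \<union> ?P2) = {}"
    by auto
  \<comment> \<open>A point strictly between the ends of an arc tells the cycles apart: equal cycles
    would put such a point on two arcs.\<close>
  have c_ends: "?P1 - {a, b} \<noteq> {}" "?P2 - {a, b} \<noteq> {}"
    using nonempty_simple_path_endless[OF arc_imp_simple_path[OF c1(1)]]
      nonempty_simple_path_endless[OF arc_imp_simple_path[OF c2(1)]] c1 c2 by auto
  note J12 = two_arcs_Jordan[OF c1 c2 i12]
  note J13 = two_arcs_Jordan[OF c1 c3 i13]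
  note J23 = two_arcs_Jordan[OF c2 c3 i23]
  have disj: "inside (?P1 \<union> ?P2) \<inter> (?P1 \<union> ?P2) = {}" "inside (?P1 \<union> ?P3) \<inter> (?P1 \<union> ?P3) = {}"
    "inside (?P2 \<union> ?P3) \<inter> (?P2 \<union> ?P3) = {}"
    by (rule inside_no_overlap)+
  obtain x where x: "x \<in> inside (?P1 \<union> ?P2)"
    using J12(1) by auto
  have "bounded (?P1 \<union> ?P2 \<union> ?P3)"
    using c1 c2 c3 by (simp add: arc_imp_path bounded_path_image)
  then obtain y where y: "y \<in> outside (?P1 \<union> ?P2 \<union> ?P3)"
    using outside_bounded_nonempty by blast
  have "x \<notin> inside (?P1 \<union> ?P3)"
  proof
    assume x': "x \<in> inside (?P1 \<union> ?P3)"
    \<comment> \<open>Each inside is connected and misses the other cycle, because by assumption no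
      arc enters an inside. Sharing \<open>x\<close>, the two insides coincide, and so do their
      frontiers, which are the cycles.\<close>
    have "inside (?P1 \<union> ?P2) \<subseteq> inside (?P1 \<union> ?P3)"
      by (rule connected_subset_inside[OF J12(2)]) (use n disj x x' in blast)+
    moreover have "inside (?P1 \<union> ?P3) \<subseteq> inside (?P1 \<union> ?P2)"
      by (rule connected_subset_inside[OF J13(2)]) (use n disj x x' in blast)+
    ultimately have "inside (?P1 \<union> ?P2) = inside (?P1 \<union> ?P3)"
      by (rule subset_antisym)
    then have "?P1 \<union> ?P2 = ?P1 \<union> ?P3"
      using J12(3) J13(3) by metis
    then show False
      using c_ends i12 i23 by blast
  qed
  moreover have "x \<notin> inside (?P2 \<union> ?P3)"
  proof
    assume x': "x \<in> inside (?P2 \<union> ?P3)"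
    have "inside (?P1 \<union> ?P2) \<subseteq> inside (?P2 \<union> ?P3)"
      by (rule connected_subset_inside[OF J12(2)]) (use n disj x x' in blast)+
    moreover have "inside (?P2 \<union> ?P3) \<subseteq> inside (?P1 \<union> ?P2)"
      by (rule connected_subset_inside[OF J23(2)]) (use n disj x x' in blast)+
    ultimately have "inside (?P1 \<union> ?P2) = inside (?P2 \<union> ?P3)"
      by (rule subset_antisym)
    then have "?P1 \<union> ?P2 = ?P2 \<union> ?P3"
      using J12(3) J23(3) by metis
    then show False
      using c_ends i12 i13 by blast
  qed
  moreover have "x \<notin> ?P1 \<union> ?P2 \<union> ?P3"
    using x n disj by blast
  ultimately have xo: "x \<in> outside (?P1 \<union> ?P3)" "x \<in> outside (?P2 \<union> ?P3)"
    by (auto simp: outside_inside)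
  have yo: "y \<in> outside (?P1 \<union> ?P3)" "y \<in> outside (?P2 \<union> ?P3)" "y \<in> outside (?P1 \<union> ?P2)"
    using y outside_mono[of _ "?P1 \<union> ?P2 \<union> ?P3"] by blast+
  have cc13: "connected_component (- (?P1 \<union> ?P3)) x y"
    by (rule connected_componentI[OF J13(4)]) (use xo yo in \<open>auto simp: outside_inside\<close>)
  have cc23: "connected_component (- (?P2 \<union> ?P3)) x y"
    by (rule connected_componentI[OF J23(4)]) (use xo yo in \<open>auto simp: outside_inside\<close>)
  \<comment> \<open>Neither of two cycles separates \<open>x\<close> from \<open>y\<close>, and they
    meet in a connected set, the arc \<open>c3\<close>; so their union does not separate them
    either. But \<open>x\<close> is inside and \<open>y\<close> outside the cycle of
    \<open>c1\<close> and \<open>c2\<close>.\<close>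
  have "(?P1 \<union> ?P3) \<inter> (?P2 \<union> ?P3) = ?P3"
    using i12 i13 by blast
  then have conn: "connected ((?P1 \<union> ?P3) \<inter> (?P2 \<union> ?P3))"
    using c3 by (simp add: arc_imp_path connected_path_image)
  have "compact (?P1 \<union> ?P3)" "closed (?P2 \<union> ?P3)"
    using c1 c2 c3 by (simp_all add: arc_imp_path compact_path_image closed_path_image compact_Un closed_Un)
  from Janiszewski[OF this conn cc13 cc23]
  have "connected_component (- (?P1 \<union> ?P2)) x y"
    by (rule connected_component_of_subset) blast
  then have "y \<in> inside (?P1 \<union> ?P2)"
    using x inside_same_component by blast
  then show False
    using yo by (auto simp: outside_inside)
qed

text \<open>
  The chord \<open>c3\<close> splits the inside of the cycle formed by \<open>c1\<close> and \<open>c2\<close>, and the chord \<open>e\<close>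
  runs on one side of it, so this side contains the far end of \<open>e\<close>.
\<close>

lemma crossing_chords_inside:
  fixes c1 c2 c3 e :: "real \<Rightarrow> complex"
  assumes c1: "arc c1" "pathstart c1 = a" "pathfinish c1 = b"
    and c2: "arc c2" "pathstart c2 = a" "pathfinish c2 = b"
    and c3: "arc c3" "pathstart c3 = a" "pathfinish c3 = b"
    and i12: "path_image c1 \<inter> path_image c2 = {a, b}"
    and i13: "path_image c1 \<inter> path_image c3 = {a, b}"
    and i23: "path_image c2 \<inter> path_image c3 = {a, b}"
    and e: "arc e" "pathstart e = u" "pathfinish e = v"
    and u: "u \<in> path_image c1 - {a, b}" and v: "v \<in> path_image c2 - {a, b}"
    and ei: "path_image e \<inter> (path_image c1 \<union> path_image c2) = {u, v}"
      "path_image e \<inter> path_image c3 = {}"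
    and in3: "path_image c3 \<inter> inside (path_image c1 \<union> path_image c2) \<noteq> {}"
    and ine: "path_image e \<inter> inside (path_image c1 \<union> path_image c2) \<noteq> {}"
  shows "u \<in> inside (path_image c2 \<union> path_image c3) \<or> v \<in> inside (path_image c1 \<union> path_image c3)"
proof -
  let ?P1 = "path_image c1" and ?P2 = "path_image c2" and ?P3 = "path_image c3"
  let ?e = "path_image e - {u, v}"
  have "a \<noteq> b"
    using arc_distinct_ends[OF c1(1)] c1 by auto
  then obtain un: "inside (?P1 \<union> ?P3) \<union> inside (?P2 \<union> ?P3) \<union> (?P3 - {a, b}) = inside (?P1 \<union> ?P2)"
    using split_inside_simple_closed_curve[OF _ c1(2,3) _ c2(2,3) _ c3(2,3) \<open>a \<noteq> b\<close> i12 i13 i23 in3]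
      c1 c2 c3 arc_imp_simple_path by blast
  have se: "simple_path e"
    using e by (simp add: arc_imp_simple_path)
  have conn: "connected ?e" and ne: "?e \<noteq> {}"
    using connected_simple_path_endless[OF se] nonempty_simple_path_endless[OF se] e by auto
  \<comment> \<open>The ends of \<open>e\<close> are limits of its inner points, so they lie in the
    closure of any region that contains these.\<close>
  have "e ` {0..1} \<subseteq> closure (e ` {0<..<1})"
    using image_closure_subset[of "{0<..<1}" e "closure (e ` {0<..<1})"] se
    by (simp add: closure_subset simple_path_def path_def)
  then have "path_image e \<subseteq> closure ?e"
    using simple_path_endless[OF se] e by (simp add: path_image_def)
  then have clo: "u \<in> closure ?e" "v \<in> closure ?e"
    using pathstart_in_path_image[of e, unfolded e(2)] pathfinish_in_path_image[of e, unfolded e(3)]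
    by blast+
  have "?e \<subseteq> inside (?P1 \<union> ?P2)"
    by (rule connected_subset_inside[OF conn]) (use ei ine inside_no_overlap[of "?P1 \<union> ?P2"] in blast)+
  then have "?e \<subseteq> inside (?P1 \<union> ?P3) \<union> inside (?P2 \<union> ?P3) \<union> (?P3 - {a, b})"
    using un by simp
  then have "?e \<subseteq> inside (?P1 \<union> ?P3) \<union> inside (?P2 \<union> ?P3)"
    using ei(2) by blast
  \<comment> \<open>Without its ends, \<open>e\<close> is connected and misses all three arcs, so it
    stays in one of the two parts. The end of \<open>e\<close> that is not on the boundary of this
    part then lies inside it.\<close>
  then consider "?e \<inter> inside (?P1 \<union> ?P3) \<noteq> {}" | "?e \<inter> inside (?P2 \<union> ?P3) \<noteq> {}"
    using ne by blast
  then show ?thesis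
  proof cases
    case 1
    have "?e \<inter> (?P1 \<union> ?P3) = {}"
      using ei by blast
    then have "?e \<subseteq> inside (?P1 \<union> ?P3)"
      using connected_subset_inside[OF conn] 1 by blast
    then have "v \<in> closure (inside (?P1 \<union> ?P3))"
      using clo closure_mono[of ?e] by blast
    moreover have "closed (?P1 \<union> ?P3)"
      using c1 c3 by (simp add: arc_imp_path closed_path_image closed_Un)
    ultimately show ?thesis
      using closure_inside_subset[of "?P1 \<union> ?P3"] v i12 i23 by blast
  next
    case 2
    have "?e \<inter> (?P2 \<union> ?P3) = {}"
      using ei by blast
    then have "?e \<subseteq> inside (?P2 \<union> ?P3)"
      using connected_subset_inside[OF conn] 2 by blast
    then have "u \<in> closure (inside (?P2 \<union> ?P3))"
      using clo closure_mono[of ?e] by blast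
    moreover have "closed (?P2 \<union> ?P3)"
      using c2 c3 by (simp add: arc_imp_path closed_path_image closed_Un)
    ultimately show ?thesis
      using closure_inside_subset[of "?P2 \<union> ?P3"] u i12 i13 by blast
  qed
qed

section \<open>Noncrossing vertex orders\<close>

abbreviation walk :: "('a \<times> 'a) set \<Rightarrow> 'a list \<Rightarrow> bool" where
  "walk E \<equiv> successively (\<lambda>x y. (x, y) \<in> E)"

definition cycle_in :: "('a \<times> 'a) set \<Rightarrow> 'a list \<Rightarrow> bool" where
  "cycle_in E xs \<longleftrightarrow> distinct xs \<and> 2 \<le> length xs \<and> walk E xs \<and> (last xs, hd xs) \<in> E"

text \<open>Edges are drawn as arcs above a line that carries the vertices in the order
  \<open>f\<close>. For symmetric \<open>E\<close> a single pattern covers every crossing, since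
  arcs can be reversed and the two edges exchanged.\<close>

definition noncrossing :: "('a \<times> 'a) set \<Rightarrow> ('a \<Rightarrow> nat) \<Rightarrow> bool" where
  "noncrossing E f \<longleftrightarrow>
     (\<forall>u v x y. (u, v) \<in> E \<longrightarrow> (x, y) \<in> E \<longrightarrow> f u < f x \<longrightarrow> f x < f v \<longrightarrow> f v < f y \<longrightarrow> False)"

text \<open>This forbids subdivisions of K_{2,3} with the branch vertices \<open>a\<close> and
  \<open>b\<close>.\<close>

definition theta_free :: "('a \<times> 'a) set \<Rightarrow> bool" where
  "theta_free E \<longleftrightarrow>
     (\<forall>a b P Q R. P \<noteq> [] \<longrightarrow> Q \<noteq> [] \<longrightarrow> R \<noteq> [] \<longrightarrow> distinct (a # b # P @ Q @ R) \<longrightarrow>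
        walk E (a # P @ [b]) \<longrightarrow> walk E (a # Q @ [b]) \<longrightarrow> walk E (a # R @ [b]) \<longrightarrow> False)"

text \<open>A cycle with two crossing chords is a subdivision of K4 in which two opposite edges are
  undivided.\<close>

definition crossing_free :: "('a \<times> 'a) set \<Rightarrow> bool" where
  "crossing_free E \<longleftrightarrow>
     (\<forall>a b c d P Q R S. cycle_in E (a # P @ b # Q @ c # R @ d # S) \<longrightarrow>
        (a, c) \<in> E \<longrightarrow> (b, d) \<in> E \<longrightarrow> False)"

lemma walk_mono: "walk E xs \<Longrightarrow> E \<subseteq> F \<Longrightarrow> walk F xs"
  by (erule successively_mono) auto

lemma theta_free_mono: "theta_free F \<Longrightarrow> E \<subseteq> F \<Longrightarrow> theta_free E"
  unfolding theta_free_def using walk_mono[of E _ F] by meson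

lemma cycle_in_mono: "cycle_in E xs \<Longrightarrow> E \<subseteq> F \<Longrightarrow> cycle_in F xs"
  unfolding cycle_in_def using walk_mono[of E xs F] by auto

lemma crossing_free_mono: "crossing_free F \<Longrightarrow> E \<subseteq> F \<Longrightarrow> crossing_free E"
  unfolding crossing_free_def using cycle_in_mono[of E _ F] by (meson subsetD)

lemma walk_rev: "sym E \<Longrightarrow> walk E xs \<Longrightarrow> walk E (rev xs)"
  by (auto simp: successively_rev elim: successively_mono dest: symD)

lemma cycle_in_rotate: "cycle_in E (xs @ ys) \<Longrightarrow> cycle_in E (ys @ xs)"
  by (cases "xs = [] \<or> ys = []") (auto simp: cycle_in_def successively_append_iff)

section \<open>Paths and longest cycles\<close>

lemma rtrancl_imp_walk:
  "(u, v) \<in> R\<^sup>* \<Longrightarrow> \<exists>xs. xs \<noteq> [] \<and> distinct xs \<and> walk R xs \<and> hd xs = u \<and> last xs = v"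
proof (induction rule: converse_rtrancl_induct)
  case base
  show ?case by (rule exI[of _ "[v]"]) simp
next
  case (step x y)
  then obtain xs where xs: "xs \<noteq> []" "distinct xs" "walk R xs" "hd xs = y" "last xs = v"
    by blast
  show ?case
  proof (cases "x \<in> set xs")
    case True
    then obtain as bs where "xs = as @ x # bs"
      by (meson split_list)
    then show ?thesis
      using xs by (intro exI[of _ "x # bs"]) (auto simp: successively_append_iff)
  next
    case False
    then show ?thesis
      using xs step.hyps by (intro exI[of _ "x # xs"]) (auto simp: successively_Cons)
  qed
qed

lemma walk_set:
  assumes "walk (E \<inter> A \<times> A) xs" "hd xs \<in> A"
  shows "set xs \<subseteq> A"
  using assms by (induction xs rule: induct_list012) auto

text \<open>
  A longest cycle (an edge counts as a cycle of length two) is Hamiltonian: otherwise some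
  component of its complement is attached to it in two vertices, and a path through
  the component either prolongs the cycle or makes it a theta graph.
\<close>

lemma Hamiltonian_cycle:
  fixes V :: "'a set"
  assumes "finite V" "sym E" "E \<subseteq> V \<times> V" "3 \<le> card V" "theta_free E"
    and conn: "\<And>w X Y. w \<in> V \<Longrightarrow> X \<noteq> {} \<Longrightarrow> Y \<noteq> {} \<Longrightarrow> X \<union> Y = V - {w} \<Longrightarrow> X \<inter> Y = {} \<Longrightarrow>
      \<exists>x\<in>X. \<exists>y\<in>Y. (x, y) \<in> E"
  shows "\<exists>xs. cycle_in E xs \<and> set xs = V"
proof -
  have cycle_sub: "set xs \<subseteq> V" if "cycle_in E xs" for xs
  proof -
    have "E \<inter> V \<times> V = E"
      using assms(3) by blast
    then show ?thesis
      using walk_set[of E V xs] that assms(3) by (auto simp: cycle_in_def)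
  qed
  \<comment> \<open>With \<open>X = {x}\<close>, \<open>conn\<close> supplies an edge at
    \<open>x\<close>, and this is a cycle of length two.\<close>
  have "\<exists>xs. cycle_in E xs"
  proof -
    obtain w where "w \<in> V"
      using assms(4) by fastforce
    have "card (V - {w}) \<ge> 2"
      using assms \<open>w \<in> V\<close> by simp
    then obtain x where x: "x \<in> V - {w}"
      by (metis card.empty ex_in_conv not_numeral_le_zero)
    have "card (V - {w} - {x}) \<ge> 1"
      using x \<open>card (V - {w}) \<ge> 2\<close> assms(1) by simp
    then have "V - {w} - {x} \<noteq> {}"
      by fastforce
    then obtain y where "(x, y) \<in> E" "x \<noteq> y"
      using conn[OF \<open>w \<in> V\<close>, of "{x}" "V - {w} - {x}"] x by blast
    then show ?thesis
      using symD[OF assms(2)] by (intro exI[of _ "[x, y]"]) (auto simp: cycle_in_def)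
  qed
  moreover have "\<forall>xs. cycle_in E xs \<longrightarrow> length xs < Suc (card V)"
    using cycle_sub assms(1) by (metis cycle_in_def card_mono distinct_card less_Suc_eq_le)
  ultimately obtain C where C: "cycle_in E C"
    and longest: "\<And>xs. cycle_in E xs \<Longrightarrow> length xs \<le> length C"
    using ex_has_greatest_nat[of "cycle_in E" _ length] by blast
  have "set C = V"
  proof (rule ccontr)
    assume "set C \<noteq> V"
    then obtain v where v: "v \<in> V" "v \<notin> set C"
      using cycle_sub[OF C] by blast
    \<comment> \<open>\<open>K\<close> is the component of \<open>v\<close> in the complement of the
      cycle, and \<open>N\<close> below is the set of its attachments.\<close>
    define R where "R = E \<inter> (- set C) \<times> (- set C)"
    define K where "K = R\<^sup>* `` {v}"
    have KV: "K \<subseteq> V - set C"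
    proof
      fix u assume "u \<in> K"
      then have "(v, u) \<in> R\<^sup>*" by (simp add: K_def)
      then show "u \<in> V - set C"
        by (cases rule: rtranclE) (use v assms(3) in \<open>auto simp: R_def\<close>)
    qed
    have vK: "v \<in> K" by (simp add: K_def)
    have K_closed: "z \<in> K" if "u \<in> K" "(u, z) \<in> E" "z \<notin> set C" for u z
    proof -
      have "(u, z) \<in> R"
        using that KV by (auto simp: R_def)
      then show ?thesis
        using that(1) by (auto simp: K_def intro: rtrancl_into_rtrancl)
    qed
    have symR: "sym R"
      using assms(2) by (auto simp: R_def sym_def)
    have lenC: "2 \<le> length C" and distC: "distinct C"
      using C by (auto simp: cycle_in_def)
    define N where "N = {c \<in> set C. \<exists>u\<in>K. (c, u) \<in> E}"
    have "\<exists>x\<in>N. \<exists>y\<in>N. x \<noteq> y"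
    proof (rule ccontr)
      assume neg: "\<not> ?thesis"
      \<comment> \<open>With at most one attachment \<open>w\<close>, deleting \<open>w\<close>
        would separate \<open>K\<close> from the rest of the cycle. Without attachments any vertex
        of the cycle serves.\<close>
      obtain w where w: "w \<in> set C" "N \<subseteq> {w}"
      proof (cases "N = {}")
        case True
        then show ?thesis
          using that[of "hd C"] lenC by (cases C) auto
      next
        case False
        then show ?thesis
          using that neg by (force simp: N_def)
      qed
      have "card (set C - {w}) \<ge> 1"
        using w(1) lenC distinct_card[OF distC] by simp
      then have "set C - {w} \<noteq> {}"
        by fastforce
      then obtain x y where xy: "x \<in> K" "y \<in> V - {w} - K" "(x, y) \<in> E"
        using conn[of w K "V - {w} - K"] w vK KV cycle_sub[OF C] by blast
      then have "y \<in> set C"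
        using K_closed by blast
      then have "y \<in> N"
        using xy symD[OF assms(2) xy(3)] by (auto simp: N_def)
      then show False
        using w xy by blast
    qed
    then obtain x y u u' where xy: "x \<in> set C" "y \<in> set C" "x \<noteq> y" "(x, u) \<in> E" "(y, u') \<in> E"
      "u \<in> K" "u' \<in> K"
      by (auto simp: N_def)
    have "(u, u') \<in> R\<^sup>*"
      using xy(6,7) sym_rtrancl[OF symR] unfolding K_def
      by (meson Image_singleton_iff rtrancl_trans symD)
    then obtain P where P: "P \<noteq> []" "distinct P" "walk R P" "hd P = u" "last P = u'"
      using rtrancl_imp_walk by metis
    have PC: "set P \<inter> set C = {}"
      using walk_set[of E "- set C" P] P xy(6) KV by (auto simp: R_def)
    have PE: "walk E P"
      using walk_mono[OF P(3)] by (auto simp: R_def)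
    have yu: "(u', y) \<in> E" "(u, x) \<in> E"
      using xy symD[OF assms(2)] by auto
    obtain as bs where "C = as @ x # bs"
      using xy(1) by (meson split_list)
    then have C': "cycle_in E (x # bs @ as)"
      using cycle_in_rotate C by fastforce
    have "y \<in> set (bs @ as)"
      using \<open>C = _\<close> xy by auto
    then obtain A B where AB: "bs @ as = A @ y # B"
      by (meson split_list)
    have lenAB: "length C = length A + length B + 2"
      using AB \<open>C = _\<close> by (metis length_append length_Cons add.commute add_Suc_right add_2_eq_Suc')
    have cAB: "cycle_in E (x # A @ y # B)"
      using C' AB by simp
    have PAB: "set P \<inter> set (x # A @ y # B) = {}"
    proof -
      have "set (x # bs @ as) = set C"
        using \<open>C = _\<close> by auto
      then show ?thesis
        using PC AB by simp
    qed
    have dist: "distinct (x # A @ y # B)" and walkC: "walk E (x # A @ y # B)"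
      and closeC: "(last (y # B), x) \<in> E"
      using cAB by (auto simp: cycle_in_def)
    have xP: "walk E (x # P @ [y])"
      using PE P xy yu by (auto simp: successively_append_iff successively_Cons)
    show False
    \<comment> \<open>An empty \<open>A\<close> or \<open>B\<close> means that \<open>x\<close> and
      \<open>y\<close> are neighbors on the cycle, so \<open>P\<close> can be inserted between them;
      otherwise \<open>A\<close>, \<open>rev B\<close> and \<open>P\<close> are the three paths of a
      theta graph.\<close>
    proof (cases "A = []")
      case True
      have "cycle_in E (x # P @ y # B)"
        using cAB True PAB P xP by (auto simp: cycle_in_def successively_append_iff successively_Cons)
      then show False
        using longest[of "x # P @ y # B"] lenAB P(1) True by (cases P) auto
    next
      case False
      show False
      proof (cases "B = []")
        case True
        have "walk E (rev P)"
          using walk_rev[OF assms(2) PE] .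
        then have "cycle_in E (x # A @ y # rev P)"
          using cAB True PAB P xy yu \<open>A \<noteq> []\<close>
          by (auto simp: cycle_in_def successively_append_iff successively_Cons hd_rev last_rev)
        then show False
          using longest[of "x # A @ y # rev P"] lenAB P(1) True by (cases P) auto
      next
        case False
        have "walk E (rev (y # B @ [x]))"
          using walkC closeC False
          by (intro walk_rev[OF assms(2)]) (auto simp: successively_append_iff successively_Cons)
        then have "walk E (x # rev B @ [y])"
          by simp
        moreover have "walk E (x # A @ [y])"
          using walkC \<open>A \<noteq> []\<close> by (auto simp: successively_append_iff successively_Cons)
        moreover have "distinct (x # y # A @ rev B @ P)"
          using dist PAB P(2) by auto
        ultimately show False
          using assms(5) xP P(1) False \<open>A \<noteq> []\<close> unfolding theta_free_def
          by (metis rev_is_Nil_conv)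
      qed
    qed
  qed
  with C show ?thesis by blast
qed

text \<open>The order is the position along the cycle: two interleaved edges become crossing chords
  once the cycle is rotated to begin with \<open>u\<close>.\<close>

lemma Hamiltonian_noncrossing:
  assumes C: "cycle_in E C" "E \<subseteq> set C \<times> set C" and "crossing_free E"
  shows "\<exists>f. inj_on f (set C) \<and> noncrossing E f"
proof -
  have dist: "distinct C"
    using C by (simp add: cycle_in_def)
  define f where "f = the_inv_into {..<length C} ((!) C)"
  have bij: "bij_betw ((!) C) {..<length C} (set C)"
    using bij_betw_nth[OF dist] by blast
  then have inj: "inj_on f (set C)"
    unfolding f_def using bij_betw_the_inv_into bij_betw_def by metis
  have f: "f v < length C \<and> C ! f v = v" if "v \<in> set C" for v
    using that bij unfolding f_def bij_betw_def
    by (metis f_the_inv_into_f lessThan_iff order_refl the_inv_into_into)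
  have split: "\<exists>as bs. xs = as @ xs ! i # bs \<and> bs = drop (Suc i) xs" if "i < length xs" for xs :: "'a list" and i
    using that id_take_nth_drop by blast
  have "False" if e: "(u, v) \<in> E" "(x, y) \<in> E" and o: "f u < f x" "f x < f v" "f v < f y" for u v x y
  proof -
    have f': "f u < length C" "f v < length C" "f x < length C" "f y < length C"
      "C ! f u = u" "C ! f v = v" "C ! f x = x" "C ! f y = y"
      using e C(2) f by blast+
    obtain as B where 1: "C = as @ u # B" "B = drop (Suc (f u)) C"
      using split[OF f'(1)] f' by metis
    have "f x - Suc (f u) < length B" "B ! (f x - Suc (f u)) = x"
      using 1(2) f' o by auto
    then obtain bs D where 2: "B = bs @ x # D" "D = drop (Suc (f x - Suc (f u))) B"
      using split by metis
    have D: "D = drop (Suc (f x)) C"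
      using 2(2) 1(2) o by simp
    have "f v - Suc (f x) < length D" "D ! (f v - Suc (f x)) = v"
      using D f' o by auto
    then obtain cs F where 3: "D = cs @ v # F" "F = drop (Suc (f v - Suc (f x))) D"
      using split by metis
    have F: "F = drop (Suc (f v)) C"
      using 3(2) D o by simp
    have "f y - Suc (f v) < length F" "F ! (f y - Suc (f v)) = y"
      using F f' o by auto
    then obtain ds G where 4: "F = ds @ y # G"
      using split by metis
    have "C = as @ (u # bs @ x # cs @ v # ds @ y # G)"
      using 1(1) 2(1) 3(1) 4 by simp
    then have "cycle_in E ((u # bs @ x # cs @ v # ds @ y # G) @ as)"
      using C(1) cycle_in_rotate by metis
    then have "cycle_in E (u # bs @ x # cs @ v # ds @ y # (G @ as))"
      by simp
    then show False
      using assms(3) e unfolding crossing_free_def by blast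
  qed
  then show ?thesis
    using inj unfolding noncrossing_def by blast
qed

text \<open>Crossing depends only on the cyclic order, so any vertex can be moved to the
  front.\<close>

lemma noncrossing_rotate:
  assumes "finite B" "inj_on f B" "noncrossing E f" "E \<subseteq> B \<times> B" "sym E" "w \<in> B"
  shows "\<exists>g. inj_on g B \<and> noncrossing E g \<and> g w = 0"
proof -
  define N where "N = Suc (Max (f ` B))"
  have N: "f v < N" if "v \<in> B" for v
    using that assms(1) by (simp add: N_def less_Suc_eq_le)
  \<comment> \<open>Vertices before \<open>w\<close> move behind all others, because
    \<open>N\<close> exceeds every value of \<open>f\<close> on \<open>B\<close>.\<close>
  define g where "g v = (if f v < f w then f v + N - f w else f v - f w)" for v
  have "inj_on g B"
  proof (rule inj_onI)
    fix x y assume "x \<in> B" "y \<in> B" "g x = g y"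
    then have "f x = f y"
      using N[of x] N[of y] N[OF assms(6)] by (auto simp: g_def split: if_splits)
    then show "x = y"
      using assms(2) \<open>x \<in> B\<close> \<open>y \<in> B\<close> by (auto dest: inj_onD)
  qed
  moreover have "False" if e: "(u, v) \<in> E" "(x, y) \<in> E" and o: "g u < g x" "g x < g v" "g v < g y" for u v x y
  proof -
    have "u \<in> B" "v \<in> B" "x \<in> B" "y \<in> B"
      using e assms(4) by auto
    then have bound: "f u < N" "f v < N" "f x < N" "f y < N" "f w < N"
      using N assms(6) by auto
    have *: "g a < g b \<longleftrightarrow> a' < w' \<and> b' < w' \<and> a' < b' \<or> w' \<le> a' \<and> w' \<le> b' \<and> a' < b' \<or> b' < w' \<and> w' \<le> a'"
      if "a \<in> {u, v, x, y}" "b \<in> {u, v, x, y}" "a' = f a" "b' = f b" "w' = f w" for a b a' b' w'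
      using that bound by (auto simp: g_def)
    \<comment> \<open>Undoing the rotation gives one of the four cyclic shifts of the interleaving,
      each of them again a crossing of the same two edges, with arcs reversed where
      necessary.\<close>
    have "f u < f x \<and> f x < f v \<and> f v < f y \<or> f x < f v \<and> f v < f y \<and> f y < f u \<or>
      f v < f y \<and> f y < f u \<and> f u < f x \<or> f y < f u \<and> f u < f x \<and> f x < f v"
      using o by (simp add: *) linarith
    moreover have "(v, u) \<in> E" "(y, x) \<in> E"
      using e assms(5) by (auto dest: symD)
    ultimately show False
      using e assms(3) unfolding noncrossing_def by blast
  qed
  moreover have "g w = 0"
    by (simp add: g_def)
  ultimately show ?thesis
    unfolding noncrossing_def by blast
qed

text \<open>\<open>B\<close> is rotated to begin with \<open>w\<close> and then inserted as one
  block in the place of \<open>w\<close> in the order of \<open>A\<close>. The only vertex of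
  \<open>A\<close> in this block is its first one, so edges of \<open>A\<close> and of
  \<open>B\<close> do not interleave.\<close>

lemma noncrossing_glue:
  assumes "finite B" "A \<inter> B = {w}" "E \<subseteq> A \<times> A \<union> B \<times> B" "sym E"
    and f: "inj_on f A" "noncrossing (E \<inter> A \<times> A) f"
    and g: "inj_on g B" "noncrossing (E \<inter> B \<times> B) g"
  shows "\<exists>h. inj_on h (A \<union> B) \<and> noncrossing E h"
proof -
  have w: "w \<in> A" "w \<in> B"
    using assms(2) by auto
  have "sym (E \<inter> B \<times> B)"
    using assms(4) by (auto simp: sym_def)
  then obtain g' where g': "inj_on g' B" "noncrossing (E \<inter> B \<times> B) g'" "g' w = 0"
    using noncrossing_rotate[OF assms(1) g _ _ w(2)] by blast
  define M where "M = Suc (Max (g' ` B))"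
  have "M > 0"
    by (simp add: M_def)
  have M: "g' v < M" if "v \<in> B" for v
    using that assms(1) by (simp add: M_def less_Suc_eq_le)
  \<comment> \<open>Multiplication by \<open>M\<close> leaves \<open>M\<close> consecutive values
    for each vertex of \<open>A\<close>, and \<open>B\<close> fits into those of \<open>w\<close>.
    Both branches agree at \<open>w\<close>, since \<open>g' w = 0\<close>.\<close>
  define h where "h v = (if v \<in> B then f w * M + g' v else f v * M)" for v
  have hB: "h v = f w * M + g' v" if "v \<in> B" for v
    using that by (simp add: h_def)
  have hA: "h v = f v * M" if "v \<in> A" for v
    using that g'(3) assms(2) by (cases "v = w") (auto simp: h_def)
  have AA: "h u < h v \<longleftrightarrow> f u < f v" if "u \<in> A" "v \<in> A" for u v
    using that \<open>M > 0\<close> by (simp add: hA)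
  have AB: "h u < h v \<longleftrightarrow> f u < f w \<or> u = w \<and> v \<noteq> w" "h v < h u \<longleftrightarrow> f w < f u"
    if uv: "u \<in> A" "v \<in> B" for u v
  proof -
    have less: "g' v < M" "v \<noteq> w \<Longrightarrow> g' v > 0"
      using M[OF uv(2)] g'(3) inj_onD[OF g'(1), of v w] uv w by auto
    have lt: "f u * M + M \<le> f w * M" if "f u < f w"
      using mult_le_mono1[of "Suc (f u)" "f w" M] that by simp
    have gt: "f w * M + M \<le> f u * M" if "f w < f u"
      using mult_le_mono1[of "Suc (f w)" "f u" M] that by simp
    consider "f u < f w" | "u = w" | "f w < f u"
      using inj_onD[OF f(1), of u w] uv w by (metis linorder_less_linear)
    then have "(h u < h v \<longleftrightarrow> f u < f w \<or> u = w \<and> v \<noteq> w) \<and> (h v < h u \<longleftrightarrow> f w < f u)"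
    proof cases
      case 1
      have "h u < h v"
        using lt[OF 1] \<open>M > 0\<close> unfolding hA[OF uv(1)] hB[OF uv(2)] by linarith
      then show ?thesis
        using 1 by auto
    next
      case 2
      have "h u < h v \<longleftrightarrow> v \<noteq> w" "\<not> h v < h u"
        using less(2) g'(3) unfolding 2 hB[OF w(2)] hB[OF uv(2)] by (cases "v = w"; simp)+
      then show ?thesis
        using 2 by simp
    next
      case 3
      have "h v < h u"
        using gt[OF 3] less(1) unfolding hA[OF uv(1)] hB[OF uv(2)] by linarith
      then show ?thesis
        using 3 by auto
    qed
    then show "h u < h v \<longleftrightarrow> f u < f w \<or> u = w \<and> v \<noteq> w" "h v < h u \<longleftrightarrow> f w < f u"
      by simp_all
  qed
  have BB: "h u < h v \<longleftrightarrow> g' u < g' v" if "u \<in> B" "v \<in> B" for u v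
    using that by (simp add: hB)
  have "inj_on h (A \<union> B)"
  proof (rule inj_onI)
    have cr: "u = v" if "u \<in> A" "v \<in> B" "h u = h v" for u v
      using AB[OF that(1,2)] that(3) inj_onD[OF f(1), of u w] that(1) w by force
    fix u v assume "u \<in> A \<union> B" "v \<in> A \<union> B" "h u = h v"
    then consider "u \<in> A" "v \<in> A" | "u \<in> A" "v \<in> B" | "u \<in> B" "v \<in> A" | "u \<in> B" "v \<in> B"
      by blast
    then show "u = v"
    proof cases
      case 1
      then show ?thesis
        using AA[of u v] AA[of v u] \<open>h u = h v\<close> inj_onD[OF f(1)] by force
    next
      case 4
      then show ?thesis
        using \<open>h u = h v\<close> inj_onD[OF g'(1)] by (simp add: hB)
    qed (use cr[of u v] cr[of v u] \<open>h u = h v\<close> in auto)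
  qed
  moreover have "False" if e: "(u, v) \<in> E" "(x, y) \<in> E" and o: "h u < h x" "h x < h v" "h v < h y" for u v x y
  proof -
    consider "u \<in> A" "v \<in> A" "x \<in> A" "y \<in> A" | "u \<in> A" "v \<in> A" "x \<in> B" "y \<in> B" |
      "u \<in> B" "v \<in> B" "x \<in> A" "y \<in> A" | "u \<in> B" "v \<in> B" "x \<in> B" "y \<in> B"
      using e assms(3) by blast
    then show False
    proof cases
      case 1
      then show ?thesis
        using e o f(2) AA unfolding noncrossing_def by blast
    next
      case 2
      then show ?thesis
        using o AB[of u x] AB[of v x] AB[of v y] by auto
    next
      case 3
      then show ?thesis
        using o AB[of x u] AB[of x v] AB[of y v] by auto
    next
      case 4
      then show ?thesis
        using e o g'(2) BB unfolding noncrossing_def by blast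
    qed
  qed
  ultimately show ?thesis
    unfolding noncrossing_def by blast
qed

theorem noncrossing_order_exists:
  assumes "finite V" "sym E" "E \<subseteq> V \<times> V" "theta_free E" "crossing_free E"
  shows "\<exists>f. inj_on f V \<and> noncrossing E f"
  using assms
proof (induction "card V" arbitrary: V E rule: less_induct)
  case less
  show ?case
  proof (cases "3 \<le> card V")
    case False
    obtain f :: "'a \<Rightarrow> nat" where f: "inj_on f V"
      using finite_imp_inj_to_nat_seg[OF less.prems(1)] by blast
    have "False" if e: "(u, v) \<in> E" "(x, y) \<in> E" and o: "f u < f x" "f x < f v" "f v < f y" for u v x y
    proof -
      have "{u, x, v} \<subseteq> V" "u \<noteq> x" "u \<noteq> v" "x \<noteq> v"
        using e o less.prems(3) by auto
      then have "3 \<le> card V"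
        using card_mono[OF less.prems(1), of "{u, x, v}"] by simp
      then show False
        using False by simp
    qed
    then show ?thesis
      using f unfolding noncrossing_def by blast
  next
    case True
    show ?thesis
    \<comment> \<open>Such a \<open>w\<close> leaves a disconnected rest, which covers cut vertices
      as well as disconnected graphs. The two sides with \<open>w\<close> added are smaller, and
      every edge lies within one of them.\<close>
    proof (cases "\<exists>w\<in>V. \<exists>X Y. X \<noteq> {} \<and> Y \<noteq> {} \<and> X \<union> Y = V - {w} \<and> X \<inter> Y = {} \<and>
        (\<forall>x\<in>X. \<forall>y\<in>Y. (x, y) \<notin> E)")
      case True
      then obtain w X Y where w: "w \<in> V" and XY: "X \<noteq> {}" "Y \<noteq> {}" "X \<union> Y = V - {w}" "X \<inter> Y = {}"
        and no: "\<And>x y. x \<in> X \<Longrightarrow> y \<in> Y \<Longrightarrow> (x, y) \<notin> E"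
        by (elim bexE exE conjE, intro that) auto
      let ?A = "insert w X" and ?B = "insert w Y"
      have part: "?A \<inter> ?B = {w}" "?A \<union> ?B = V" "?A \<subset> V" "?B \<subset> V"
        using w XY by blast+
      have fin: "finite ?A" "finite ?B"
        using part(3,4) less.prems(1) by (meson finite_subset psubset_imp_subset)+
      have IH: "\<exists>f. inj_on f Z \<and> noncrossing (E \<inter> Z \<times> Z) f" if "Z \<subset> V" for Z
      proof (rule less.hyps)
        show "card Z < card V" "finite Z"
          using that less.prems(1) by (auto intro: psubset_card_mono finite_subset)
        show "theta_free (E \<inter> Z \<times> Z)"
          by (rule theta_free_mono[OF less.prems(4)]) simp
        show "crossing_free (E \<inter> Z \<times> Z)"
          by (rule crossing_free_mono[OF less.prems(5)]) simp
      qed (use less.prems(2) in \<open>auto simp: sym_def\<close>)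
      have "E \<subseteq> ?A \<times> ?A \<union> ?B \<times> ?B"
      proof
        fix e assume "e \<in> E"
        then obtain x y where "e = (x, y)" "(x, y) \<in> E" "(y, x) \<in> E"
          using symD[OF less.prems(2)] by (cases e) auto
        then show "e \<in> ?A \<times> ?A \<union> ?B \<times> ?B"
          using no less.prems(3) part(2) by auto
      qed
      then show ?thesis
        using noncrossing_glue[OF fin(2) part(1) _ less.prems(2)] IH[OF part(3)] IH[OF part(4)] part(2)
        by metis
    next
      case False
      then have "\<exists>xs. cycle_in E xs \<and> set xs = V"
        using Hamiltonian_cycle[OF less.prems(1,2,3) True less.prems(4)] by metis
      then show ?thesis
        using Hamiltonian_noncrossing less.prems(3,5) by metis
    qed
  qed
qed

section \<open>Outerplane drawings\<close>

lemma pair_graphD: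
  assumes "pair_graph G"
  shows "finite (pverts G)" "parcs G \<subseteq> pverts G \<times> pverts G" "sym (parcs G)"
    and "\<And>u v. (u, v) \<in> parcs G \<Longrightarrow> u \<noteq> v"
proof -
  interpret pair_graph G by (rule assms)
  show "finite (pverts G)" "parcs G \<subseteq> pverts G \<times> pverts G" "sym (parcs G)"
    using in_arcsD1 in_arcsD2 pair_sym_arcs by (auto simp: symmetric_def)
  show "u \<noteq> v" if "(u, v) \<in> parcs G" for u v
    using pair_no_loops[OF that] by simp
qed

section \<open>Walks and their drawings\<close>

fun walk_arcs :: "'a list \<Rightarrow> ('a \<times> 'a) set" where
  "walk_arcs (x # y # zs) = insert (x, y) (walk_arcs (y # zs))"
| "walk_arcs _ = {}"

lemma walk_iff_arcs: "walk E xs \<longleftrightarrow> walk_arcs xs \<subseteq> E"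
  by (induction xs rule: walk_arcs.induct) auto

lemma walk_arcs_append: "walk_arcs (xs @ v # ys) = walk_arcs (xs @ [v]) \<union> walk_arcs (v # ys)"
  by (induction xs rule: walk_arcs.induct) auto

lemma walk_arcs_rev: "walk_arcs (rev xs) = (walk_arcs xs)\<inverse>"
proof (induction xs rule: walk_arcs.induct)
  case (1 x y zs)
  then show ?case
    using walk_arcs_append[of "rev zs" y "[x]"] by auto
qed auto

lemma walk_arcs_subset: "walk_arcs xs \<subseteq> set xs \<times> set xs"
  by (induction xs rule: walk_arcs.induct) auto

text \<open>This serves the hypothesis \<open>sep\<close> of \<open>drawn_walk_Int\<close> for two
  walks with the same ends: the detour contains no edge that the other walk could share.\<close>

lemma walk_arcs_detour:
  assumes "distinct (x # P @ [y])" "P \<noteq> []" "(u, v) \<in> walk_arcs (x # P @ [y])"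
  shows "\<not> {u, v} \<subseteq> {x, y}"
proof -
  have "walk_arcs zs \<subseteq> set (butlast zs) \<times> set (tl zs)" for zs :: "'a list"
    by (induction zs rule: walk_arcs.induct) auto
  from this[of "x # P @ [y]"] have "u \<noteq> y" "v \<noteq> x"
    using assms by (auto simp: butlast_append)
  moreover have "(x, y) \<notin> walk_arcs (x # P @ [y])"
    using assms walk_arcs_subset[of "P @ [y]"] by (cases P) auto
  ultimately show ?thesis
    using assms(3) by auto
qed

locale plane_graph =
  fixes G :: "'a pair_pre_digraph" and p :: "'a \<Rightarrow> complex" and \<gamma> :: "'a \<times> 'a \<Rightarrow> real \<Rightarrow> complex"
  assumes graph: "pair_graph G" and drawing: "plane_drawing G p \<gamma>"
begin

definition drawn_walk :: "'a list \<Rightarrow> complex set" where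
  "drawn_walk xs = p ` set xs \<union> (\<Union>e\<in>walk_arcs xs. path_image (\<gamma> e))"

lemma inj_p: "inj_on p (pverts G)"
  using drawing by (simp add: plane_drawing_def)

lemma arcD:
  assumes "(u, v) \<in> parcs G"
  shows "arc (\<gamma> (u, v))" "pathstart (\<gamma> (u, v)) = p u" "pathfinish (\<gamma> (u, v)) = p v"
    "\<gamma> (v, u) = reversepath (\<gamma> (u, v))" "path_image (\<gamma> (u, v)) \<inter> p ` pverts G = {p u, p v}"
  using drawing assms unfolding plane_drawing_def by blast+

lemma arcs_Int:
  assumes "(u, v) \<in> parcs G" "(x, y) \<in> parcs G" "{u, v} \<noteq> {x, y}"
  shows "path_image (\<gamma> (u, v)) \<inter> path_image (\<gamma> (x, y)) \<subseteq> p ` pverts G"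
  using drawing assms unfolding plane_drawing_def by blast

lemmas arcs_subset = pair_graphD(2)[OF graph]

lemmas sym_arcs = pair_graphD(3)[OF graph]

lemma walk_verts:
  assumes "walk (parcs G) xs" "2 \<le> length xs"
  shows "set xs \<subseteq> pverts G"
  using assms
proof (induction xs rule: induct_list012)
  case (3 x y zs)
  then show ?case
    using arcs_subset by (cases zs) auto
qed auto

text \<open>By \<open>sep\<close> the walks have no common edge, so a common point off the vertices
  would lie on two different edges. Hence it is a drawn vertex, and edges pass through no vertices
  other than their ends.\<close>

lemma drawn_walk_Int:
  assumes "walk (parcs G) xs" "walk (parcs G) ys" "2 \<le> length xs" "2 \<le> length ys"
    and sep: "\<And>u v. (u, v) \<in> walk_arcs xs \<Longrightarrow> \<not> {u, v} \<subseteq> set ys"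
  shows "drawn_walk xs \<inter> drawn_walk ys = p ` (set xs \<inter> set ys)"
proof -
  note V = walk_verts[OF assms(1,3)] walk_verts[OF assms(2,4)]
  have on_vert: "z \<in> p ` set zs" if z: "walk (parcs G) zs" "z \<in> drawn_walk zs" "z \<in> p ` pverts G" for z zs
  proof (cases "z \<in> p ` set zs")
    case False
    then obtain u v where uv: "(u, v) \<in> walk_arcs zs" "z \<in> path_image (\<gamma> (u, v))"
      using z(2) by (auto simp: drawn_walk_def)
    then have "(u, v) \<in> parcs G"
      using z(1) by (auto simp: walk_iff_arcs)
    then have "z \<in> {p u, p v}"
      using arcD(5) uv(2) z(3) by blast
    then show ?thesis
      using walk_arcs_subset[of zs] uv(1) by auto
  qed
  have "z \<in> p ` (set xs \<inter> set ys)" if z: "z \<in> drawn_walk xs" "z \<in> drawn_walk ys" for z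
  proof -
    have "z \<in> p ` pverts G"
    proof (rule ccontr)
      assume nz: "z \<notin> p ` pverts G"
      then obtain u v x y where uv: "(u, v) \<in> walk_arcs xs" "z \<in> path_image (\<gamma> (u, v))"
        and xy: "(x, y) \<in> walk_arcs ys" "z \<in> path_image (\<gamma> (x, y))"
        using z V by (auto simp: drawn_walk_def)
      have "{u, v} \<noteq> {x, y}"
        using sep[OF uv(1)] walk_arcs_subset[of ys] xy(1) by auto
      then show False
        using arcs_Int[of u v x y] uv xy nz assms(1,2) by (auto simp: walk_iff_arcs)
    qed
    then have "z \<in> p ` set xs" "z \<in> p ` set ys"
      using on_vert assms(1,2) z by blast+
    then show ?thesis
      using inj_on_image_Int[OF inj_p V] by blast
  qed
  then show ?thesis
    by (auto simp: drawn_walk_def)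
qed

lemma walk_arc:
  assumes "walk (parcs G) xs" "distinct xs" "2 \<le> length xs"
  shows "\<exists>g. arc g \<and> pathstart g = p (hd xs) \<and> pathfinish g = p (last xs) \<and> path_image g = drawn_walk xs"
  using assms
proof (induction xs rule: walk_arcs.induct)
  case (1 x y zs)
  have xy: "(x, y) \<in> parcs G"
    using 1 by simp
  have img: "path_image (\<gamma> (x, y)) = drawn_walk [x, y]"
    using arcD(5)[OF xy] by (auto simp: drawn_walk_def)
  show ?case
  proof (cases zs)
    case Nil
    then show ?thesis
      using arcD[OF xy] img by (intro exI[of _ "\<gamma> (x, y)"]) simp
  next
    case (Cons w ws)
    then obtain g where g: "arc g" "pathstart g = p y" "pathfinish g = p (last (y # zs))"
      "path_image g = drawn_walk (y # zs)"
      using 1 by auto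
    have "path_image (\<gamma> (x, y)) \<inter> path_image g = p ` (set [x, y] \<inter> set (y # zs))"
      unfolding img g(4) by (rule drawn_walk_Int) (use 1 Cons in auto)
    also have "\<dots> = {p y}"
      using 1(3) by auto
    finally have "arc (\<gamma> (x, y) +++ g)"
      using arcD[OF xy] g by (intro arc_join) auto
    moreover have "path_image (\<gamma> (x, y) +++ g) = drawn_walk (x # y # zs)"
      using arcD(3)[OF xy] g(2,4) img by (auto simp: path_image_join drawn_walk_def)
    ultimately show ?thesis
      using arcD[OF xy] g by (intro exI[of _ "\<gamma> (x, y) +++ g"]) simp
  qed
qed auto

lemma drawn_walk_append: "drawn_walk (xs @ v # ys) = drawn_walk (xs @ [v]) \<union> drawn_walk (v # ys)"
  unfolding drawn_walk_def walk_arcs_append[of xs v ys] by auto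

lemma drawn_walk_rev:
  assumes "walk (parcs G) xs"
  shows "drawn_walk (rev xs) = drawn_walk xs"
proof -
  have "path_image (\<gamma> (v, u)) = path_image (\<gamma> (u, v))" if "(u, v) \<in> walk_arcs xs" for u v
    using that assms arcD(4)[of u v] by (auto simp: walk_iff_arcs)
  then have "(\<Union>e\<in>walk_arcs xs. path_image (\<gamma> (prod.swap e))) = (\<Union>e\<in>walk_arcs xs. path_image (\<gamma> e))"
    by (intro SUP_cong) auto
  moreover have "(\<Union>e\<in>(walk_arcs xs)\<inverse>. path_image (\<gamma> e)) = (\<Union>e\<in>walk_arcs xs. path_image (\<gamma> (prod.swap e)))"
    by force
  ultimately show ?thesis
    unfolding drawn_walk_def walk_arcs_rev by simp
qed

lemma closed_drawn_walk:
  assumes "walk (parcs G) xs"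
  shows "closed (drawn_walk xs)"
proof -
  have "finite (walk_arcs xs)"
    using walk_arcs_subset finite_subset by fast
  moreover have "closed (path_image (\<gamma> e))" if "e \<in> walk_arcs xs" for e
    using that assms arcD(1) by (cases e) (auto simp: walk_iff_arcs closed_arc_image)
  ultimately show ?thesis
    unfolding drawn_walk_def by (intro closed_Un closed_UN finite_imp_closed) auto
qed

lemma drawn_walk_subset:
  assumes "walk (parcs G) xs" "2 \<le> length xs"
  shows "drawn_walk xs \<subseteq> drawn_set G p \<gamma>"
  using walk_verts[OF assms] assms(1) by (auto simp: drawn_walk_def drawn_set_def walk_iff_arcs)

end

section \<open>Drawings with all vertices on the outer face\<close>

locale outerplane_graph = plane_graph +
  assumes outer: "p ` pverts G \<subseteq> frontier (outside (drawn_set G p \<gamma>))"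
begin

text \<open>A part of the drawing has a larger outside, so the vertex remains a limit of outside
  points, and the closure of the outside adds only points of \<open>S\<close>.\<close>

lemma vertex_not_inside:
  assumes "closed S" "S \<subseteq> drawn_set G p \<gamma>" "v \<in> pverts G"
  shows "p v \<notin> inside S"
proof -
  have "p v \<in> closure (outside (drawn_set G p \<gamma>))"
    using outer assms(3) by (auto simp: frontier_def)
  then have "p v \<in> closure (outside S)"
    using closure_mono[OF outside_mono[OF assms(2)]] by blast
  then have "p v \<in> S \<union> outside S"
    using closure_outside_subset[OF assms(1)] by blast
  then show ?thesis
    using inside_no_overlap[of S] unfolding outside_inside by blast
qed

text \<open>Between its ends the walk is connected and misses \<open>S\<close>, so entering
  \<open>inside S\<close> would take the vertex \<open>hd P\<close> along.\<close>

lemma walk_not_inside: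
  assumes "closed S" "S \<subseteq> drawn_set G p \<gamma>"
    and w: "walk (parcs G) (a # P @ [b])" "distinct (a # P @ [b])" "P \<noteq> []"
    and i: "drawn_walk (a # P @ [b]) \<inter> S = {p a, p b}"
  shows "drawn_walk (a # P @ [b]) \<inter> inside S = {}"
proof (rule ccontr)
  assume ne: "\<not> ?thesis"
  obtain g where g: "arc g" "pathstart g = p a" "pathfinish g = p b"
    "path_image g = drawn_walk (a # P @ [b])"
    using walk_arc[OF w(1,2)] w(3) by fastforce
  have V: "set (a # P @ [b]) \<subseteq> pverts G"
    by (rule walk_verts[OF w(1)]) simp
  let ?T = "path_image g - {p a, p b}"
  have "connected ?T"
    using connected_simple_path_endless[OF arc_imp_simple_path[OF g(1)]] g by simp
  moreover have "?T \<inter> S = {}"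
    using g(4) i by blast
  moreover have "?T \<inter> inside S \<noteq> {}"
    using ne g(4) i inside_no_overlap[of S] by blast
  ultimately have "?T \<subseteq> inside S"
    by (rule connected_subset_inside)
  moreover have "p (hd P) \<in> ?T"
  proof -
    have "hd P \<in> pverts G" "hd P \<noteq> a" "hd P \<noteq> b"
      using w V by (auto simp: neq_Nil_conv)
    moreover have "p (hd P) \<in> drawn_walk (a # P @ [b])"
      using w(3) by (auto simp: drawn_walk_def)
    ultimately show ?thesis
      using V inj_onD[OF inj_p] g(4) by auto
  qed
  moreover have "hd P \<in> pverts G"
    using w(3) V by (auto simp: neq_Nil_conv)
  ultimately show False
    using vertex_not_inside[OF assms(1,2)] by blast
qed

text \<open>\<open>Q\<close> may be empty, so that the second walk can be a chord
  \<open>ab\<close>.\<close>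

lemma drawn_detours_Int:
  assumes "walk (parcs G) (a # P @ [b])" "walk (parcs G) (a # Q @ [b])"
    and "P \<noteq> []" "distinct (a # b # P @ Q)"
  shows "drawn_walk (a # P @ [b]) \<inter> drawn_walk (a # Q @ [b]) = {p a, p b}"
proof -
  have "\<not> {u, v} \<subseteq> set (a # Q @ [b])" if "(u, v) \<in> walk_arcs (a # P @ [b])" for u v
    using walk_arcs_detour[OF _ assms(3) that] walk_arcs_subset[of "a # P @ [b]"] that assms(4)
    by fastforce
  then have "drawn_walk (a # P @ [b]) \<inter> drawn_walk (a # Q @ [b])
    = p ` (set (a # P @ [b]) \<inter> set (a # Q @ [b]))"
    by (intro drawn_walk_Int assms) auto
  also have "set (a # P @ [b]) \<inter> set (a # Q @ [b]) = {a, b}"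
    using assms(4) by auto
  finally show ?thesis by simp
qed

lemma detour_not_inside:
  assumes w: "walk (parcs G) (a # P @ [b])" "walk (parcs G) (a # Q @ [b])" "walk (parcs G) (a # R @ [b])"
    and "P \<noteq> []" "distinct (a # b # P @ Q @ R)"
  shows "drawn_walk (a # P @ [b]) \<inter> inside (drawn_walk (a # Q @ [b]) \<union> drawn_walk (a # R @ [b])) = {}"
proof (rule walk_not_inside)
  have "drawn_walk (a # P @ [b]) \<inter> drawn_walk (a # Q @ [b]) = {p a, p b}"
    "drawn_walk (a # P @ [b]) \<inter> drawn_walk (a # R @ [b]) = {p a, p b}"
    by (rule drawn_detours_Int; use assms in auto)+
  then show "drawn_walk (a # P @ [b]) \<inter> (drawn_walk (a # Q @ [b]) \<union> drawn_walk (a # R @ [b])) = {p a, p b}"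
    by blast
  show "closed (drawn_walk (a # Q @ [b]) \<union> drawn_walk (a # R @ [b]))"
    using w closed_drawn_walk by blast
  show "drawn_walk (a # Q @ [b]) \<union> drawn_walk (a # R @ [b]) \<subseteq> drawn_set G p \<gamma>"
    using drawn_walk_subset[OF w(2)] drawn_walk_subset[OF w(3)] by auto
qed (use assms in auto)

text \<open>One of the three arcs runs inside the other two, and the vertices in \<open>P\<close>
  and \<open>Q\<close> bar the first two from it. For \<open>R = []\<close> this forces a chord into
  its cycle.\<close>

lemma third_detour_inside:
  assumes w: "walk (parcs G) (a # P @ [b])" "walk (parcs G) (a # Q @ [b])" "walk (parcs G) (a # R @ [b])"
    and ne: "P \<noteq> []" "Q \<noteq> []" and dist: "distinct (a # b # P @ Q @ R)"
  shows "drawn_walk (a # R @ [b]) \<inter> inside (drawn_walk (a # P @ [b]) \<union> drawn_walk (a # Q @ [b])) \<noteq> {}"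
proof -
  have "\<exists>g. arc g \<and> pathstart g = p a \<and> pathfinish g = p b \<and> path_image g = drawn_walk (a # X @ [b])"
    if "walk (parcs G) (a # X @ [b])" "distinct (a # b # X)" for X
    using walk_arc[OF that(1)] that(2) by auto
  then obtain g1 g2 g3 where g1: "arc g1" "pathstart g1 = p a" "pathfinish g1 = p b"
      and i1: "path_image g1 = drawn_walk (a # P @ [b])"
    and g2: "arc g2" "pathstart g2 = p a" "pathfinish g2 = p b"
      and i2: "path_image g2 = drawn_walk (a # Q @ [b])"
    and g3: "arc g3" "pathstart g3 = p a" "pathfinish g3 = p b"
      and i3: "path_image g3 = drawn_walk (a # R @ [b])"
    using w dist by (metis distinct_append distinct.simps(2) UnCI set_append list.set_intros(2) distinct_length_2_or_more)
  have Int: "path_image g1 \<inter> path_image g2 = {p a, p b}" "path_image g1 \<inter> path_image g3 = {p a, p b}"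
    "path_image g2 \<inter> path_image g3 = {p a, p b}"
    unfolding i1 i2 i3 by (rule drawn_detours_Int; use assms in auto)+
  have "path_image g1 \<inter> inside (path_image g2 \<union> path_image g3) = {}"
    unfolding i1 i2 i3 by (rule detour_not_inside) (use assms in auto)
  moreover have "path_image g2 \<inter> inside (path_image g1 \<union> path_image g3) = {}"
    unfolding i1 i2 i3 by (rule detour_not_inside) (use assms in auto)
  ultimately show ?thesis
    using theta_curve_inside[OF g1 g2 g3 Int] unfolding i1 i2 i3 by blast
qed

theorem theta_free_arcs: "theta_free (parcs G)"
proof -
  have "False" if "P \<noteq> []" "Q \<noteq> []" "R \<noteq> []" "distinct (a # b # P @ Q @ R)"
    "walk (parcs G) (a # P @ [b])" "walk (parcs G) (a # Q @ [b])" "walk (parcs G) (a # R @ [b])"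
    for a b P Q R
    using third_detour_inside[of a P b Q R] detour_not_inside[of a R b P Q] that by auto
  then show ?thesis
    unfolding theta_free_def by blast
qed

theorem crossing_free_arcs: "crossing_free (parcs G)"
proof -
  have False if C: "cycle_in (parcs G) (a # P @ b # Q @ c # R @ d # S)"
    and ac: "(a, c) \<in> parcs G" and bd: "(b, d) \<in> parcs G" for a b c d P Q R S
  proof -
    have dist: "distinct (a # P @ b # Q @ c # R @ d # S)"
      using C by (simp add: cycle_in_def)
    have seg: "walk (parcs G) (a # P @ [b])" "walk (parcs G) (b # Q @ [c])"
      "walk (parcs G) (c # R @ [d])" "walk (parcs G) (d # S @ [a])"
      using C by (auto simp: cycle_in_def successively_append_iff successively_Cons hd_append split: if_splits)
    \<comment> \<open>The cycle is cut at \<open>a\<close>, \<open>c\<close> into \<open>?A\<close>,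
      \<open>?B\<close> and at \<open>b\<close>, \<open>d\<close> into \<open>?A'\<close>,
      \<open>?B'\<close>. The second halves are reversed so that both halves run between the same
      ends in the same direction.\<close>
    let ?A = "P @ b # Q" and ?B = "rev S @ d # rev R"
    let ?A' = "Q @ c # R" and ?B' = "rev P @ a # rev S"
    have w1: "walk (parcs G) (a # ?A @ [c])" and w1': "walk (parcs G) (b # ?A' @ [d])"
      and r2: "walk (parcs G) (c # R @ d # S @ [a])" and r2': "walk (parcs G) (d # S @ a # P @ [b])"
      using seg by (auto simp: successively_append_iff successively_Cons hd_append split: if_splits)
    have w2: "walk (parcs G) (a # ?B @ [c])" and w2': "walk (parcs G) (b # ?B' @ [d])"
      using walk_rev[OF sym_arcs r2] walk_rev[OF sym_arcs r2'] by simp_all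
    have w3: "walk (parcs G) (a # [] @ [c])" and w3': "walk (parcs G) (b # [] @ [d])"
      using ac bd by auto
    have d1: "drawn_walk (a # ?A @ [c]) = drawn_walk (a # P @ [b]) \<union> drawn_walk (b # Q @ [c])"
      using drawn_walk_append[of "a # P" b "Q @ [c]"] by simp
    have d1': "drawn_walk (b # ?A' @ [d]) = drawn_walk (b # Q @ [c]) \<union> drawn_walk (c # R @ [d])"
      using drawn_walk_append[of "b # Q" c "R @ [d]"] by simp
    have d2: "drawn_walk (a # ?B @ [c]) = drawn_walk (c # R @ [d]) \<union> drawn_walk (d # S @ [a])"
      using drawn_walk_append[of "c # R" d "S @ [a]"] drawn_walk_rev[OF r2] by simp
    have d2': "drawn_walk (b # ?B' @ [d]) = drawn_walk (d # S @ [a]) \<union> drawn_walk (a # P @ [b])"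
      using drawn_walk_append[of "d # S" a "P @ [b]"] drawn_walk_rev[OF r2'] by simp
    have same: "drawn_walk (b # ?A' @ [d]) \<union> drawn_walk (b # ?B' @ [d]) =
      drawn_walk (a # ?A @ [c]) \<union> drawn_walk (a # ?B @ [c])"
      unfolding d1 d1' d2 d2' by blast
    \<comment> \<open>Each chord is forced inside with respect to its own way of cutting the cycle;
      by \<open>same\<close> this is one and the same curve.\<close>
    have ac_in: "drawn_walk (a # [] @ [c]) \<inter> inside (drawn_walk (a # ?A @ [c]) \<union> drawn_walk (a # ?B @ [c])) \<noteq> {}"
      by (rule third_detour_inside[OF w1 w2 w3]) (use dist in auto)
    have bd_in: "drawn_walk (b # [] @ [d]) \<inter> inside (drawn_walk (a # ?A @ [c]) \<union> drawn_walk (a # ?B @ [c])) \<noteq> {}"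
      unfolding same[symmetric] by (rule third_detour_inside[OF w1' w2' w3']) (use dist in auto)
    have i12: "drawn_walk (a # ?A @ [c]) \<inter> drawn_walk (a # ?B @ [c]) = {p a, p c}"
      by (rule drawn_detours_Int[OF w1 w2]) (use dist in auto)
    have i13: "drawn_walk (a # ?A @ [c]) \<inter> drawn_walk (a # [] @ [c]) = {p a, p c}"
      by (rule drawn_detours_Int[OF w1 w3]) (use dist in auto)
    have i23: "drawn_walk (a # ?B @ [c]) \<inter> drawn_walk (a # [] @ [c]) = {p a, p c}"
      by (rule drawn_detours_Int[OF w2 w3]) (use dist in auto)
    have e1: "drawn_walk (b # [] @ [d]) \<inter> drawn_walk (a # ?A @ [c]) = p ` (set (b # [] @ [d]) \<inter> set (a # ?A @ [c]))"
      by (rule drawn_walk_Int[OF w3' w1]) (use dist in auto)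
    have e2: "drawn_walk (b # [] @ [d]) \<inter> drawn_walk (a # ?B @ [c]) = p ` (set (b # [] @ [d]) \<inter> set (a # ?B @ [c]))"
      by (rule drawn_walk_Int[OF w3' w2]) (use dist in auto)
    have e3: "set (b # [] @ [d]) \<inter> set (a # ?A @ [c]) = {b}" "set (b # [] @ [d]) \<inter> set (a # ?B @ [c]) = {d}"
      using dist by auto
    have ei: "drawn_walk (b # [] @ [d]) \<inter> (drawn_walk (a # ?A @ [c]) \<union> drawn_walk (a # ?B @ [c])) = {p b, p d}"
      unfolding Int_Un_distrib e1 e2 e3 by auto
    have "drawn_walk (b # [] @ [d]) \<inter> drawn_walk (a # [] @ [c]) = p ` (set (b # [] @ [d]) \<inter> set (a # [] @ [c]))"
      by (rule drawn_walk_Int[OF w3' w3]) (use dist in auto)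
    then have ei3: "drawn_walk (b # [] @ [d]) \<inter> drawn_walk (a # [] @ [c]) = {}"
      using dist by auto
    obtain g1 where g1: "arc g1" "pathstart g1 = p a" "pathfinish g1 = p c"
      and j1: "path_image g1 = drawn_walk (a # ?A @ [c])"
      using walk_arc[OF w1] dist by fastforce
    obtain g2 where g2: "arc g2" "pathstart g2 = p a" "pathfinish g2 = p c"
      and j2: "path_image g2 = drawn_walk (a # ?B @ [c])"
      using walk_arc[OF w2] dist by fastforce
    obtain g3 where g3: "arc g3" "pathstart g3 = p a" "pathfinish g3 = p c"
      and j3: "path_image g3 = drawn_walk (a # [] @ [c])"
      using walk_arc[OF w3] dist by fastforce
    obtain e where e: "arc e" "pathstart e = p b" "pathfinish e = p d"
      and je: "path_image e = drawn_walk (b # [] @ [d])"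
      using walk_arc[OF w3'] dist by fastforce
    have V: "a \<in> pverts G" "b \<in> pverts G" "c \<in> pverts G" "d \<in> pverts G"
      using ac bd arcs_subset by auto
    then have pne: "p b \<noteq> p a" "p b \<noteq> p c" "p d \<noteq> p a" "p d \<noteq> p c"
      using dist inj_onD[OF inj_p] by fastforce+
    have mem: "p b \<in> drawn_walk (a # ?A @ [c])" "p d \<in> drawn_walk (a # ?B @ [c])"
      by (auto simp: drawn_walk_def)
    \<comment> \<open>An end of \<open>bd\<close> would lie inside a smaller cycle of the drawing,
      which \<open>vertex_not_inside\<close> forbids.\<close>
    have "p b \<in> inside (path_image g2 \<union> path_image g3) \<or> p d \<in> inside (path_image g1 \<union> path_image g3)"
      by (rule crossing_chords_inside[OF g1 g2 g3 _ _ _ e])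
        (use i12 i13 i23 ei ei3 ac_in bd_in mem pne in \<open>auto simp: j1 j2 j3 je\<close>)
    moreover have "p b \<notin> inside (path_image g2 \<union> path_image g3)"
      unfolding j2 j3 using closed_drawn_walk[OF w2] closed_drawn_walk[OF w3]
        drawn_walk_subset[OF w2] drawn_walk_subset[OF w3] V
      by (intro vertex_not_inside) auto
    moreover have "p d \<notin> inside (path_image g1 \<union> path_image g3)"
      unfolding j1 j3 using closed_drawn_walk[OF w1] closed_drawn_walk[OF w3]
        drawn_walk_subset[OF w1] drawn_walk_subset[OF w3] V
      by (intro vertex_not_inside) auto
    ultimately show False by blast
  qed
  then show ?thesis
    unfolding crossing_free_def by blast
qed

end

lemma outerplanar_imp_noncrossing:
  fixes G :: "'a pair_pre_digraph"
  assumes "pair_graph G" "outerplanar G"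
  shows "\<exists>f. inj_on f (pverts G) \<and> noncrossing (parcs G) f"
proof -
  obtain p \<gamma> where d: "plane_drawing G p \<gamma>" "p ` pverts G \<subseteq> frontier (outside (drawn_set G p \<gamma>))"
    using assms(2) by (auto simp: outerplanar_def)
  then interpret outerplane_graph G p \<gamma>
    by (intro outerplane_graph.intro plane_graph.intro outerplane_graph_axioms.intro assms d)
  show ?thesis
    by (rule noncrossing_order_exists[OF pair_graphD(1)[OF assms(1)] sym_arcs arcs_subset theta_free_arcs crossing_free_arcs])
qed

section \<open>Convex drawings\<close>

text \<open>On a strictly convex curve all chords run above, which leaves the vertices accessible
  from the unbounded region below.\<close>

definition parabola :: "real \<Rightarrow> complex" where
  "parabola a = Complex a (a\<^sup>2)"

text \<open>The product \<open>(Re z - a) * (b - Re z)\<close> is the height of the chord above the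
  parabola, positive strictly between the ends.\<close>

lemma parabola_chord:
  assumes "z \<in> closed_segment (parabola a) (parabola b)" "a \<le> b"
  shows "a \<le> Re z" "Re z \<le> b" "Im z = (Re z)\<^sup>2 + (Re z - a) * (b - Re z)"
proof -
  obtain t where t: "z = (1 - t) *\<^sub>R parabola a + t *\<^sub>R parabola b" "0 \<le> t" "t \<le> 1"
    using assms(1) by (auto simp: closed_segment_def)
  then have re: "Re z = a + t * (b - a)" and im: "Im z = (1 - t) * a\<^sup>2 + t * b\<^sup>2"
    unfolding t(1) by (simp_all add: parabola_def algebra_simps)
  have "t * (b - a) \<le> 1 * (b - a)" "0 \<le> t * (b - a)"
    using t(2,3) assms(2) by (auto simp: mult_left_le_one_le)
  then show "a \<le> Re z" "Re z \<le> b"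
    using re by auto
  show "Im z = (Re z)\<^sup>2 + (Re z - a) * (b - Re z)"
    unfolding re im by (simp add: power2_eq_square algebra_simps)
qed

lemma parabola_chord_end:
  assumes "z \<in> closed_segment (parabola a) (parabola b)" "a \<le> b" "Re z = a \<or> Re z = b"
  shows "z = parabola (Re z)"
  using parabola_chord(3)[OF assms(1,2)] assms(3) by (auto simp: parabola_def complex_eq_iff)

text \<open>The equation says that the two chords meet above \<open>r\<close>. Intervals around
  \<open>r\<close> that do not interleave are nested, and the chord of the larger one is higher
  above \<open>r\<close> unless the ends agree.\<close>

lemma noncrossing_chords:
  fixes a b c d r :: real
  assumes "a < r" "r < b" "c < r" "r < d" "(r - a) * (b - r) = (r - c) * (d - r)"
    and "\<not> (a < c \<and> c < b \<and> b < d)" "\<not> (c < a \<and> a < d \<and> d < b)"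
  shows "a = c \<and> b = d"
proof -
  have nested: "a' = c' \<and> b' = d'"
    if "c' \<le> a'" "b' \<le> d'" "a' < r" "r < b'" "(r - a') * (b' - r) = (r - c') * (d' - r)"
    for a' b' c' d' :: real
  proof -
    have "(r - a') * (b' - r) \<le> (r - a') * (d' - r)"
      by (rule mult_left_mono) (use that in linarith)+
    moreover have "(r - a') * (d' - r) \<le> (r - c') * (d' - r)"
      by (rule mult_right_mono) (use that in linarith)+
    ultimately have "(r - a') * (b' - r) = (r - a') * (d' - r)" "(r - a') * (d' - r) = (r - c') * (d' - r)"
      using that(5) by linarith+
    moreover have "r - a' \<noteq> 0" "d' - r \<noteq> 0"
      using that by auto
    ultimately have "b' - r = d' - r" "r - a' = r - c'"
      by (metis mult_left_cancel, metis mult_right_cancel)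
    then show ?thesis
      by simp
  qed
  consider "c \<le> a" "b \<le> d" | "a \<le> c" "d \<le> b"
    using assms by linarith
  then show ?thesis
    using nested[of c a b d] nested[of a c d b] assms by cases auto
qed

theorem noncrossing_imp_outerplanar:
  fixes G :: "'a pair_pre_digraph"
  assumes G: "pair_graph G" and inj: "inj_on f (pverts G)" and nc: "noncrossing (parcs G) f"
  shows "outerplanar G"
proof -
  note G = pair_graphD[OF G]
  define p where "p v = parabola (real (f v))" for v
  define \<gamma> where "\<gamma> e = linepath (p (fst e)) (p (snd e))" for e
  have V: "u \<in> pverts G" "v \<in> pverts G" if "(u, v) \<in> parcs G" for u v
    using that G(2) by auto
  have ne: "f u \<noteq> f v" if "(u, v) \<in> parcs G" for u v
    using V[OF that] G(4)[OF that] inj_onD[OF inj, of u v] by auto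
  have swap: "(v, u) \<in> parcs G" if "(u, v) \<in> parcs G" for u v
    using that G(3) by (auto dest: symD)
  have p_eq: "p u = p v \<longleftrightarrow> f u = f v" for u v
    by (auto simp: p_def parabola_def)
  have Re_p: "Re (p v) = real (f v)" for v
    by (simp add: p_def parabola_def)
  have img: "path_image (\<gamma> (u, v)) = closed_segment (parabola (f u)) (parabola (f v))" for u v
    by (simp add: \<gamma>_def p_def)
  have img_sym: "path_image (\<gamma> (v, u)) = path_image (\<gamma> (u, v))" for u v
    by (simp add: img closed_segment_commute)
  have on_vertex: "path_image (\<gamma> (u, v)) \<inter> p ` pverts G = {p u, p v}"
    if "(u, v) \<in> parcs G" "f u < f v" for u v
  proof -
    have "p w = p u \<or> p w = p v" if "p w \<in> path_image (\<gamma> (u, v))" for w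
    proof -
      \<comment> \<open>A drawn vertex has height zero above the parabola, so one of the two factors
        vanishes.\<close>
      have "(real (f w))\<^sup>2 = (real (f w))\<^sup>2 + (real (f w) - f u) * (f v - real (f w))"
        using parabola_chord(3)[of "p w" "f u" "f v"] that \<open>f u < f v\<close>
        by (simp add: img) (simp add: p_def parabola_def)
      then show ?thesis
        by (auto simp: p_eq)
    qed
    moreover have "p u \<in> path_image (\<gamma> (u, v))" "p v \<in> path_image (\<gamma> (u, v))"
      by (simp_all add: \<gamma>_def)
    ultimately show ?thesis
      using V[OF that(1)] by auto
  qed
  have meet: "path_image (\<gamma> (u, v)) \<inter> path_image (\<gamma> (x, y)) \<subseteq> p ` pverts G"
    if uv: "(u, v) \<in> parcs G" "f u < f v" and xy: "(x, y) \<in> parcs G" "f x < f y"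
      and diff: "{u, v} \<noteq> {x, y}" for u v x y
  proof
    fix z assume z: "z \<in> path_image (\<gamma> (u, v)) \<inter> path_image (\<gamma> (x, y))"
    then have s1: "z \<in> closed_segment (parabola (f u)) (parabola (f v))"
      and s2: "z \<in> closed_segment (parabola (f x)) (parabola (f y))"
      by (auto simp: img)
    note c1 = parabola_chord[OF s1] and c2 = parabola_chord[OF s2]
    have "\<not> (f u < f x \<and> f x < f v \<and> f v < f y)" "\<not> (f x < f u \<and> f u < f y \<and> f y < f v)"
      using nc uv xy unfolding noncrossing_def by blast+
    moreover have "\<not> (f u = f x \<and> f v = f y)"
      using diff V[OF uv(1)] V[OF xy(1)] inj_onD[OF inj] by blast
    \<comment> \<open>Otherwise \<open>Re z\<close> is strictly inside both intervals, and the two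
      edges would have the same ends.\<close>
    ultimately have "Re z = f u \<or> Re z = f v \<or> Re z = f x \<or> Re z = f y"
      using noncrossing_chords[of "f u" "Re z" "f v" "f x" "f y"] c1 c2 uv(2) xy(2) by force
    moreover have "z = parabola (Re z)" if "Re z = f u \<or> Re z = f v"
      using parabola_chord_end[OF s1 _ that] uv by simp
    moreover have "z = parabola (Re z)" if "Re z = f x \<or> Re z = f y"
      using parabola_chord_end[OF s2 _ that] xy by simp
    ultimately have "z = p u \<or> z = p v \<or> z = p x \<or> z = p y"
      by (auto simp: p_def)
    then show "z \<in> p ` pverts G"
      using V[OF uv(1)] V[OF xy(1)] by auto
  qed
  have "plane_drawing G p \<gamma>"
  proof -
    have "inj_on p (pverts G)"
      using inj by (simp add: inj_on_def p_eq)
    moreover have "arc (\<gamma> (u, v)) \<and> pathstart (\<gamma> (u, v)) = p u \<and> pathfinish (\<gamma> (u, v)) = p v \<and>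
        \<gamma> (v, u) = reversepath (\<gamma> (u, v)) \<and> path_image (\<gamma> (u, v)) \<inter> p ` pverts G = {p u, p v}"
      if uv: "(u, v) \<in> parcs G" for u v
    proof -
    have "p u \<noteq> p v"
      using ne[OF uv] by (simp add: p_eq)
    moreover have "path_image (\<gamma> (u, v)) \<inter> p ` pverts G = {p u, p v}"
      using on_vertex[of u v] on_vertex[of v u] uv swap[OF uv] ne[OF uv] img_sym[of u v]
      by (metis insert_commute linorder_less_linear)
    ultimately show ?thesis
      by (simp add: \<gamma>_def)
    qed
    moreover have "path_image (\<gamma> (u, v)) \<inter> path_image (\<gamma> (x, y)) \<subseteq> p ` pverts G"
      if uv: "(u, v) \<in> parcs G" and xy: "(x, y) \<in> parcs G" and d: "{u, v} \<noteq> {x, y}" for u v x y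
    proof -
      \<comment> \<open>Each edge is represented by its left-to-right arc, the orientation treated
        in \<open>meet\<close>.\<close>
      obtain u' v' where uv': "(u', v') \<in> parcs G" "f u' < f v'" "{u', v'} = {u, v}"
        "path_image (\<gamma> (u', v')) = path_image (\<gamma> (u, v))"
        using uv swap[OF uv] ne[OF uv] img_sym[of u v] by (metis insert_commute linorder_less_linear)
      obtain x' y' where xy': "(x', y') \<in> parcs G" "f x' < f y'" "{x', y'} = {x, y}"
        "path_image (\<gamma> (x', y')) = path_image (\<gamma> (x, y))"
        using xy swap[OF xy] ne[OF xy] img_sym[of x y] by (metis insert_commute linorder_less_linear)
      show ?thesis
        using meet[OF uv'(1,2) xy'(1,2)] d uv' xy' by simp
    qed
    ultimately show ?thesis
      unfolding plane_drawing_def by (intro conjI ballI case_prodI2 impI) (simp_all split: prod.splits)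
  qed
  moreover have "p ` pverts G \<subseteq> frontier (outside (drawn_set G p \<gamma>))"
  proof
    have above: "(Re z)\<^sup>2 \<le> Im z" if z: "z \<in> drawn_set G p \<gamma>" for z
    proof (cases "z \<in> p ` pverts G")
      case True
      then show ?thesis by (auto simp: p_def parabola_def)
    next
      case False
      then obtain u v where "(u, v) \<in> parcs G" "z \<in> path_image (\<gamma> (u, v))"
        using z by (auto simp: drawn_set_def)
      then obtain u' v' where "f u' < f v'" "z \<in> path_image (\<gamma> (u', v'))"
        using ne[of u v] img_sym[of u v] by (metis linorder_less_linear)
      then show ?thesis
        using parabola_chord[of z "f u'" "f v'"] by (simp add: img)
    qed
    have below: "w \<in> outside (drawn_set G p \<gamma>)" if w: "Im w < (Re w)\<^sup>2" for w
    proof -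
      \<comment> \<open>\<open>T\<close> is the vertical ray downward from \<open>w\<close>. It
        stays below the parabola, hence off the drawing, and it is unbounded.\<close>
      define T where "T = (\<lambda>s. w - of_real s * \<i>) ` {0..}"
      have "Im z < (Re z)\<^sup>2" if "z \<in> T" for z
        using that w by (auto simp: T_def)
      then have "T \<subseteq> - drawn_set G p \<gamma>"
        using above by force
      moreover have "connected T"
        unfolding T_def by (intro connected_continuous_image continuous_intros) auto
      moreover have "w \<in> T"
        unfolding T_def by (rule image_eqI[of _ _ 0]) auto
      ultimately have "T \<subseteq> connected_component_set (- drawn_set G p \<gamma>) w"
        by (intro connected_component_maximal)
      moreover have "\<not> bounded T"
      proof
        assume "bounded T"
        then obtain B where B: "norm z \<le> B" if "z \<in> T" for z
          by (auto simp: bounded_iff)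
        let ?s = "\<bar>Im w\<bar> + \<bar>B\<bar> + 1"
        have "norm (w - of_real ?s * \<i>) \<le> B"
          by (rule B, unfold T_def, rule imageI) simp
        moreover have "\<bar>Im (w - of_real ?s * \<i>)\<bar> \<le> norm (w - of_real ?s * \<i>)"
          by (rule abs_Im_le_cmod)
        moreover have "Im (w - of_real ?s * \<i>) = Im w - ?s"
          by simp
        ultimately show False
          by linarith
      qed
      ultimately show ?thesis
        unfolding outside using bounded_subset by blast
    qed
    fix z assume z: "z \<in> p ` pverts G"
    then have zIm: "Im z = (Re z)\<^sup>2"
      by (auto simp: p_def parabola_def)
    have "z \<in> drawn_set G p \<gamma>"
      using z by (auto simp: drawn_set_def)
    then have "z \<notin> outside (drawn_set G p \<gamma>)"
      using outside_no_overlap by blast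
    moreover have "z \<in> closure (outside (drawn_set G p \<gamma>))"
      unfolding closure_approachable
    proof (intro allI impI)
      fix e :: real assume "0 < e"
      then have "z - of_real (e / 2) * \<i> \<in> outside (drawn_set G p \<gamma>)"
        using zIm by (intro below) simp
      moreover have "dist (z - of_real (e / 2) * \<i>) z < e"
        using \<open>0 < e\<close> by (simp add: dist_norm norm_mult)
      ultimately show "\<exists>y\<in>outside (drawn_set G p \<gamma>). dist y z < e" ..
    qed
    ultimately show "z \<in> frontier (outside (drawn_set G p \<gamma>))"
      using interior_subset by (auto simp: frontier_def)
  qed
  ultimately show ?thesis
    unfolding outerplanar_def by blast
qed

section \<open>Colorings of triangulated polygons\<close>

lemma proper_coloring_pair:
  "proper_coloring (with_proj G) k c \<longleftrightarrow>
    c \<in> pverts G \<rightarrow>\<^sub>E {1..k} \<and> (\<forall>u v. (u, v) \<in> parcs G \<longrightarrow> c u \<noteq> c v)"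
  by (auto simp: proper_coloring_def)

text \<open>The common ground of fans and maximal outerplanar graphs. The side \<open>ab\<close>
  closes the polygon, and each edge with vertices between its ends carries a triangle on that side;
  descending from \<open>ab\<close> reaches all vertices.\<close>

locale triangulated_polygon =
  fixes G :: "'a pair_pre_digraph" and f :: "'a \<Rightarrow> nat" and a b :: 'a
  assumes graph: "pair_graph G"
    and inj: "inj_on f (pverts G)"
    and noncrossing: "noncrossing (parcs G) f"
    and ab: "(a, b) \<in> parcs G" "f a < f b"
    and first_last: "\<And>v. v \<in> pverts G \<Longrightarrow> f a \<le> f v \<and> f v \<le> f b"
    and order: "3 \<le> card (pverts G)"
    and triangle: "\<And>i j v. (i, j) \<in> parcs G \<Longrightarrow> v \<in> pverts G \<Longrightarrow> f i < f v \<Longrightarrow> f v < f j \<Longrightarrow>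
      \<exists>k. f i < f k \<and> f k < f j \<and> (i, k) \<in> parcs G \<and> (k, j) \<in> parcs G"
begin

section \<open>Colorings of the part cut off by an edge\<close>

definition stretch :: "'a \<Rightarrow> 'a \<Rightarrow> 'a set" where
  "stretch i j = {v \<in> pverts G. f i \<le> f v \<and> f v \<le> f j}"

lemma vertsD: "(u, v) \<in> parcs G \<Longrightarrow> u \<in> pverts G" "(u, v) \<in> parcs G \<Longrightarrow> v \<in> pverts G"
  using pair_graphD(2)[OF graph] by auto

lemma arc_sym: "(u, v) \<in> parcs G \<Longrightarrow> (v, u) \<in> parcs G"
  using pair_graphD(3)[OF graph] by (rule symD)

lemma f_eq: "u \<in> pverts G \<Longrightarrow> v \<in> pverts G \<Longrightarrow> f u = f v \<longleftrightarrow> u = v"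
  using inj by (auto dest: inj_onD)

lemma stretch_short:
  assumes "(i, j) \<in> parcs G" "\<not> (\<exists>v\<in>pverts G. f i < f v \<and> f v < f j)"
  shows "stretch i j \<subseteq> {i, j}"
proof
  fix v assume "v \<in> stretch i j"
  then have "f v = f i \<or> f v = f j" "v \<in> pverts G"
    using assms(2) by (auto simp: stretch_def le_less)
  then show "v \<in> {i, j}"
    using f_eq vertsD[OF assms(1)] by auto
qed

text \<open>The third vertex \<open>k\<close> of the triangle on \<open>ij\<close> must receive the
  third color; then \<open>ik\<close> and \<open>kj\<close> cut off shorter stretches.\<close>

lemma coloring_unique_on_stretch:
  assumes "(i, j) \<in> parcs G" "f i < f j"
    and "c i = c' i" "c j = c' j"
    and c: "c \<in> pverts G \<rightarrow> {1..3::nat}" "\<And>u v. (u, v) \<in> parcs G \<Longrightarrow> c u \<noteq> c v"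
    and c': "c' \<in> pverts G \<rightarrow> {1..3::nat}" "\<And>u v. (u, v) \<in> parcs G \<Longrightarrow> c' u \<noteq> c' v"
    and "v \<in> stretch i j"
  shows "c v = c' v"
  using assms(1-4,9)
proof (induction "f j - f i" arbitrary: i j rule: less_induct)
  case less
  show ?case
  proof (cases "\<exists>v\<in>pverts G. f i < f v \<and> f v < f j")
    case False
    then show ?thesis
      using stretch_short[OF less.prems(1)] less.prems by auto
  next
    case True
    then obtain k where k: "f i < f k" "f k < f j" "(i, k) \<in> parcs G" "(k, j) \<in> parcs G"
      using triangle[OF less.prems(1)] by blast
    have V: "i \<in> pverts G" "j \<in> pverts G" "k \<in> pverts G"
      using vertsD less.prems(1) k by auto
    have "c i \<in> {1..3}" "c j \<in> {1..3}" "c k \<in> {1..3}" "c' k \<in> {1..3}"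
      using c(1) c'(1) V by auto
    moreover have "c i \<noteq> c j" "c i \<noteq> c k" "c k \<noteq> c j" "c' i \<noteq> c' k" "c' k \<noteq> c' j"
      using c(2) c'(2) less.prems(1) k by auto
    ultimately have "c k = c' k"
      unfolding atLeastAtMost_iff using less.prems(3,4) by linarith
    moreover have "v \<in> stretch i k \<or> v \<in> stretch k j"
      using less.prems(5) by (auto simp: stretch_def)
    ultimately show ?thesis
      using less.hyps[of k i] less.hyps[of j k] k less.prems(3,4) by auto
  qed
qed

text \<open>The colors at both ends are prescribed so that the colorings of the two shorter
  stretches can be made to agree at \<open>k\<close>.\<close>

lemma coloring_exists_on_stretch:
  assumes "(i, j) \<in> parcs G" "f i < f j" "x \<in> {1..3::nat}" "y \<in> {1..3}" "x \<noteq> y"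
  shows "\<exists>c. c i = x \<and> c j = y \<and> (\<forall>v. c v \<in> {1..3}) \<and>
    (\<forall>u v. (u, v) \<in> parcs G \<longrightarrow> f u < f v \<longrightarrow> u \<in> stretch i j \<longrightarrow> v \<in> stretch i j \<longrightarrow> c u \<noteq> c v)"
  using assms
proof (induction "f j - f i" arbitrary: i j x y rule: less_induct)
  case less
  show ?case
  proof (cases "\<exists>v\<in>pverts G. f i < f v \<and> f v < f j")
    case False
    then show ?thesis
      using stretch_short[OF less.prems(1)] less.prems
      by (intro exI[of _ "\<lambda>v. if v = i then x else y"]) auto
  next
    case True
    then obtain k where k: "f i < f k" "f k < f j" "(i, k) \<in> parcs G" "(k, j) \<in> parcs G"
      using triangle[OF less.prems(1)] by blast
    obtain z where z: "z \<in> {1..3}" "z \<noteq> x" "z \<noteq> y"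
    proof -
      have "1 \<noteq> x \<and> 1 \<noteq> y \<or> 2 \<noteq> x \<and> 2 \<noteq> y \<or> 3 \<noteq> x \<and> 3 \<noteq> y"
        using less.prems(5) by auto
      then show thesis
        using that[of 1] that[of 2] that[of 3] by auto
    qed
    have less_ik: "f k - f i < f j - f i" and less_kj: "f j - f k < f j - f i"
      using k by linarith+
    obtain c1 where c1: "c1 i = x" "c1 k = z" "\<And>v. c1 v \<in> {1..3}"
      "\<And>u v. (u, v) \<in> parcs G \<Longrightarrow> f u < f v \<Longrightarrow> u \<in> stretch i k \<Longrightarrow> v \<in> stretch i k \<Longrightarrow> c1 u \<noteq> c1 v"
      using less.hyps[OF less_ik k(3,1) less.prems(3) z(1) z(2)[symmetric]] by blast
    obtain c2 where c2: "c2 k = z" "c2 j = y" "\<And>v. c2 v \<in> {1..3}"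
      "\<And>u v. (u, v) \<in> parcs G \<Longrightarrow> f u < f v \<Longrightarrow> u \<in> stretch k j \<Longrightarrow> v \<in> stretch k j \<Longrightarrow> c2 u \<noteq> c2 v"
      using less.hyps[OF less_kj k(4,2) z(1) less.prems(4) z(3)] by blast
    define c where "c v = (if f v \<le> f k then c1 v else c2 v)" for v
    have "c u \<noteq> c v" if uv: "(u, v) \<in> parcs G" "f u < f v" "u \<in> stretch i j" "v \<in> stretch i j" for u v
    proof -
      have V: "u \<in> pverts G" "v \<in> pverts G" "k \<in> pverts G" "i \<in> pverts G" "j \<in> pverts G"
        using vertsD uv(1) k by auto
      consider "f v \<le> f k" | "f u < f k" "f k < f v" | "f k \<le> f u" by linarith
      then show ?thesis
      proof cases
        case 1
        then show ?thesis
          using c1(4)[OF uv(1,2)] uv by (auto simp: c_def stretch_def)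
      next
        case 2
        \<comment> \<open>An edge over \<open>k\<close> that starts after \<open>i\<close> would
          cross \<open>ik\<close>, and one that ends before \<open>j\<close> would cross
          \<open>kj\<close>; only \<open>ij\<close> itself remains.\<close>
        have "\<not> f i < f u" "\<not> f v < f j"
          using 2 k uv(1) noncrossing unfolding noncrossing_def by blast+
        then have "u = i" "v = j"
          using uv(3,4) V f_eq by (auto simp: stretch_def)
        then show ?thesis
          using k less.prems(5) c1(1) c2(2) by (simp add: c_def)
      next
        case 3
        have "c w = c2 w" if "w \<in> pverts G" "f k \<le> f w" for w
          using that c1(2) c2(1) f_eq[of w k] V(3) by (auto simp: c_def)
        then show ?thesis
          using c2(4)[OF uv(1,2)] uv 3 V by (auto simp: stretch_def)
      qed
    qed
    moreover have "c i = x" "c j = y" "\<And>v. c v \<in> {1..3}"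
      using c1(1,3) c2(2,3) k by (auto simp: c_def)
    ultimately show ?thesis
      by blast
  qed
qed

lemma stretch_all: "stretch a b = pverts G"
  using first_last by (auto simp: stretch_def)

lemma proper_coloring_3_exists: "\<exists>c. proper_coloring (with_proj G) 3 c"
proof -
  obtain c where c: "\<And>v. c v \<in> {1..3::nat}"
    "\<And>u v. (u, v) \<in> parcs G \<Longrightarrow> f u < f v \<Longrightarrow> u \<in> stretch a b \<Longrightarrow> v \<in> stretch a b \<Longrightarrow> c u \<noteq> c v"
    using coloring_exists_on_stretch[OF ab, of 1 2] by auto
  have "c u \<noteq> c v" if uv: "(u, v) \<in> parcs G" for u v
  proof -
    have "f u \<noteq> f v"
      using pair_graphD(4)[OF graph uv] f_eq vertsD[OF uv] by blast
    then show ?thesis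
      using c(2)[OF uv] c(2)[OF arc_sym[OF uv]] vertsD[OF uv] by (force simp: stretch_all)
  qed
  then have "proper_coloring (with_proj G) 3 (restrict c (pverts G))"
    using c(1) vertsD by (auto simp: proper_coloring_pair)
  then show ?thesis
    by blast
qed

lemma triangle_exists: "\<exists>t. (a, t) \<in> parcs G \<and> (t, b) \<in> parcs G"
proof -
  have "pverts G \<noteq> {a, b}" "\<not> pverts G \<subseteq> {a, b}"
    using order card_mono[of "{a, b}" "pverts G"] card_insert_le_m1[of 2 "{b}" a] by auto
  then obtain v where v: "v \<in> pverts G" "v \<noteq> a" "v \<noteq> b"
    by blast
  then have "f a < f v" "f v < f b"
    using first_last[OF v(1)] f_eq vertsD[OF ab(1)] by (auto simp: le_less)
  then show ?thesis
    using triangle[OF ab(1) v(1)] by blast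
qed

lemma chromatic_number_3: "chromatic_number (with_proj G) = 3"
  unfolding chromatic_number_def
proof (rule Least_equality)
  show "\<exists>c. proper_coloring (with_proj G) 3 c"
    by (rule proper_coloring_3_exists)
  fix k assume "\<exists>c. proper_coloring (with_proj G) k c"
  then obtain c where c: "c \<in> pverts G \<rightarrow>\<^sub>E {1..k}" "\<And>u v. (u, v) \<in> parcs G \<Longrightarrow> c u \<noteq> c v"
    by (auto simp: proper_coloring_pair)
  obtain t where t: "(a, t) \<in> parcs G" "(t, b) \<in> parcs G"
    using triangle_exists by blast
  have "{c a, c t, c b} \<subseteq> {1..k}"
    using c(1) vertsD ab(1) t by auto
  moreover have "card {c a, c t, c b} = 3"
    using c(2)[OF ab(1)] c(2)[OF t(1)] c(2)[OF t(2)] by auto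
  ultimately show "3 \<le> k"
    using card_mono[of "{1..k}" "{c a, c t, c b}"] by simp
qed

lemma sudoku_coloring_edge: "\<exists>c. sudoku_coloring (with_proj G) {a, b} (restrict c {a, b})"
proof -
  obtain c where c: "proper_coloring (with_proj G) 3 c"
    using proper_coloring_3_exists by blast
  have V: "a \<in> pverts G" "b \<in> pverts G"
    using vertsD ab(1) by auto
  have "partial_coloring (with_proj G) {a, b} (restrict c {a, b})"
    unfolding partial_coloring_def chromatic_number_3
    using c V by (auto simp: proper_coloring_def)
  moreover have "c' = c" if c': "proper_coloring (with_proj G) 3 c'" "restrict c' {a, b} = restrict c {a, b}" for c'
  proof -
    have "c' a = c a" "c' b = c b"
      using fun_cong[OF c'(2)] by (metis insertCI restrict_apply')+
    then have "c' v = c v" if "v \<in> pverts G" for v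
      using coloring_unique_on_stretch[OF ab, of c' c v] c c'(1) that
      by (auto simp: proper_coloring_pair stretch_all PiE_def)
    then show ?thesis
      using c c'(1) by (intro extensionalityI[of _ "pverts G"]) (auto simp: proper_coloring_pair PiE_def)
  qed
  ultimately show ?thesis
    using c unfolding sudoku_coloring_def chromatic_number_3 by blast
qed

lemma sudoku_coloring_card:
  assumes "sudoku_coloring (with_proj G) S c0"
  shows "2 \<le> card S"
proof (rule ccontr)
  assume small: "\<not> 2 \<le> card S"
  obtain c where c: "proper_coloring (with_proj G) 3 c" "restrict c S = c0"
    and uniq: "\<And>c'. proper_coloring (with_proj G) 3 c' \<Longrightarrow> restrict c' S = c0 \<Longrightarrow> c' = c"
    using assms unfolding sudoku_coloring_def chromatic_number_3 by blast
  have "S \<subseteq> pverts G"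
    using assms by (auto simp: sudoku_coloring_def partial_coloring_def)
  then have "finite S"
    using pair_graphD(1)[OF graph] finite_subset by blast
  \<comment> \<open>For empty \<open>S\<close> the choice of \<open>s\<close> is arbitrary, and
    \<open>c s\<close> may even be \<open>undefined\<close>. This is harmless: at most one of the
    three colors of the triangle equals it.\<close>
  then obtain s where s: "S \<subseteq> {s}"
    using small card_le_Suc0_iff_eq[of S] by (cases "S = {}") auto
  obtain t where t: "(a, t) \<in> parcs G" "(t, b) \<in> parcs G"
    using triangle_exists by blast
  have "c a \<noteq> c t" "c t \<noteq> c b" "c a \<noteq> c b"
    using c(1) t ab(1) by (auto simp: proper_coloring_pair)
  moreover have "a \<in> pverts G" "b \<in> pverts G" "t \<in> pverts G"
    using vertsD t by auto
  ultimately obtain v w where vw: "v \<in> pverts G" "w \<in> pverts G" "c v \<noteq> c w" "c v \<noteq> c s" "c w \<noteq> c s"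
    by metis
  \<comment> \<open>Exchanging two colors other than \<open>c s\<close> keeps the coloring proper
    and unchanged on \<open>S\<close>, yet recolors \<open>v\<close>. The restriction keeps the
    function extensional.\<close>
  define c' where "c' = restrict (Transposition.transpose (c v) (c w) \<circ> c) (pverts G)"
  have "Transposition.transpose (c v) (c w) (c u) \<in> {1..3}" if "u \<in> pverts G" for u
  proof -
    have "c v \<in> {1..3}" "c w \<in> {1..3}" "c u \<in> {1..3}"
      using c(1) vw(1,2) that by (auto simp: proper_coloring_pair)
    then show ?thesis
      by (auto simp: Transposition.transpose_def)
  qed
  moreover have "Transposition.transpose (c v) (c w) x \<noteq> Transposition.transpose (c v) (c w) y" if "x \<noteq> y" for x y
    using that by (metis transpose_involutory)
  ultimately have "proper_coloring (with_proj G) 3 c'"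
    using c(1) vertsD by (simp add: proper_coloring_pair c'_def)
  moreover have "restrict c' S = c0"
    unfolding c(2)[symmetric] c'_def using s vw \<open>S \<subseteq> pverts G\<close>
    by (intro ext) (auto simp: restrict_def)
  ultimately have "c' = c"
    by (rule uniq)
  moreover have "c' v = c w"
    using vw(1) by (simp add: c'_def)
  ultimately show False
    using vw(3) by simp
qed

theorem sudoku_number_2: "sudoku_number (with_proj G) = 2"
  unfolding sudoku_number_def
proof (rule Least_equality)
  have "card {a, b} = 2"
    using ab(2) by (auto simp: card_insert_if)
  then show "\<exists>S c0. sudoku_coloring (with_proj G) S c0 \<and> card S = 2"
    using sudoku_coloring_edge by blast
qed (use sudoku_coloring_card in auto)

end

section \<open>Fan graphs\<close>

lemma sudoku_number_fan_graph:
  assumes "2 \<le> n"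
  shows "sudoku_number (with_proj (fan_graph n)) = 2"
proof -
  have arcs: "(i, j) \<in> parcs (fan_graph n) \<longleftrightarrow>
      1 \<le> i \<and> i < n \<and> j = Suc i \<or> 1 \<le> j \<and> j < n \<and> i = Suc j \<or>
      i = 0 \<and> 1 \<le> j \<and> j \<le> n \<or> j = 0 \<and> 1 \<le> i \<and> i \<le> n" for i j
    by (auto simp: fan_graph_def Let_def)
  have verts: "pverts (fan_graph n) = {0..n}"
    by (simp add: fan_graph_def Let_def)
  have "noncrossing (parcs (fan_graph n)) id"
    unfolding noncrossing_def arcs id_apply by linarith
  moreover have "\<exists>k. id i < id k \<and> id k < id j \<and> (i, k) \<in> parcs (fan_graph n) \<and> (k, j) \<in> parcs (fan_graph n)"
    if "(i, j) \<in> parcs (fan_graph n)" "id i < id v" "id v < id j" for i j v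
  proof -
    \<comment> \<open>Consecutive path vertices have nothing between them, so \<open>ij\<close> is
      an edge at the hub, and the third vertex of its triangle is the path neighbor
      \<open>j - 1\<close>.\<close>
    have "i = 0" "2 \<le> j" "j \<le> n"
      using that unfolding arcs id_apply by linarith+
    then show ?thesis
      unfolding arcs by (intro exI[of _ "j - 1"]) auto
  qed
  \<comment> \<open>The closing side joins the hub to the last path vertex.\<close>
  ultimately interpret triangulated_polygon "fan_graph n" id 0 n
    using assms by (intro triangulated_polygon.intro pair_graph_fan_graph) (auto simp: verts arcs)
  show ?thesis
    by (rule sudoku_number_2)
qed

section \<open>Maximal outerplanar graphs\<close>

lemma pair_graph_add_edge:
  assumes "pair_graph G" "u \<in> pverts G" "v \<in> pverts G" "u \<noteq> v"
  shows "pair_graph (G\<lparr>parcs := parcs G \<union> {(u, v), (v, u)}\<rparr>)"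
proof
  note G = pair_graphD[OF assms(1)]
  show "finite (parcs (G\<lparr>parcs := parcs G \<union> {(u, v), (v, u)}\<rparr>))"
    using G(1,2) by (simp add: finite_subset)
qed (use assms pair_graphD[OF assms(1)] in \<open>auto simp: symmetric_def sym_def\<close>)

text \<open>If \<open>f\<close> stayed noncrossing after adding \<open>uv\<close>, the enlarged
  graph would have a convex drawing, against maximality. The end of the crossing edge between
  \<open>u\<close> and \<open>v\<close> is named \<open>x\<close>.\<close>

lemma nonadjacent_crossed:
  assumes G: "pair_graph G" "maximal_outerplanar G" and f: "inj_on f (pverts G)" "noncrossing (parcs G) f"
    and uv: "u \<in> pverts G" "v \<in> pverts G" "(u, v) \<notin> parcs G" "f u < f v"
  shows "\<exists>x y. (x, y) \<in> parcs G \<and> f u < f x \<and> f x < f v \<and> (f y < f u \<or> f v < f y)"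
proof -
  let ?G = "G\<lparr>parcs := parcs G \<union> {(u, v), (v, u)}\<rparr>"
  have "u \<noteq> v" using uv(4) by auto
  then have "\<not> outerplanar ?G" "pair_graph ?G"
    using G uv pair_graph_add_edge[OF G(1)] by (auto simp: maximal_outerplanar_def)
  then have "\<not> noncrossing (parcs ?G) f"
    using noncrossing_imp_outerplanar[of ?G f] f(1) by auto
  then obtain q r s t where "(q, r) \<in> parcs ?G" "(s, t) \<in> parcs ?G"
    and o: "f q < f s" "f s < f r" "f r < f t"
    unfolding noncrossing_def by blast
  \<comment> \<open>The two new arcs have the same ends and cannot interleave with each other, and
    \<open>f u < f v\<close> decides which of them occurs.\<close>
  then consider "(q, r) \<in> parcs G" "(s, t) \<in> parcs G" | "q = u" "r = v" "(s, t) \<in> parcs G" |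
    "(q, r) \<in> parcs G" "s = u" "t = v"
    using uv(4) by auto
  then show ?thesis
  proof cases
    case 1
    then show ?thesis
      using f(2) o unfolding noncrossing_def by blast
  next
    case 2
    then show ?thesis
      using o by blast
  next
    case 3
    then have "(r, q) \<in> parcs G"
      using pair_graphD(3)[OF G(1)] by (auto dest: symD)
    then show ?thesis
      using o 3 by blast
  qed
qed

lemma sudoku_number_maximal_outerplanar:
  assumes G: "pair_graph G" "maximal_outerplanar G" "3 \<le> card (pverts G)"
  shows "sudoku_number (with_proj G) = 2"
proof -
  note gr = pair_graphD[OF G(1)]
  obtain f where f: "inj_on f (pverts G)" "noncrossing (parcs G) f"
    using outerplanar_imp_noncrossing[OF G(1)] G(2) by (auto simp: maximal_outerplanar_def)
  note crossed = nonadjacent_crossed[OF G(1,2) f]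
  have sy: "(v, u) \<in> parcs G" if "(u, v) \<in> parcs G" for u v
    using that gr(3) by (auto dest: symD)
  have ne: "pverts G \<noteq> {}"
    using G(3) by auto
  obtain a where a: "a \<in> pverts G" "\<And>v. v \<in> pverts G \<Longrightarrow> f a \<le> f v"
    using ne ex_has_least_nat[of "\<lambda>v. v \<in> pverts G" _ f] by blast
  have "f v < Suc (Max (f ` pverts G))" if "v \<in> pverts G" for v
    using that gr(1) by (simp add: less_Suc_eq_le)
  then obtain b where b: "b \<in> pverts G" "\<And>v. v \<in> pverts G \<Longrightarrow> f v \<le> f b"
    using ne ex_has_greatest_nat[of "\<lambda>v. v \<in> pverts G" _ f] by blast
  interpret triangulated_polygon G f a b
  proof (rule triangulated_polygon.intro)
    show "f a < f b"
    proof (rule ccontr)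
      assume "\<not> f a < f b"
      then have "f v = f a" if "v \<in> pverts G" for v
        using a(2)[OF that] b(2)[OF that] by simp
      then have "pverts G \<subseteq> {a}"
        using inj_onD[OF f(1)] a(1) by blast
      then show False
        using G(3) card_mono[of "{a}" "pverts G"] by simp
    qed
    \<comment> \<open>No vertex lies beyond \<open>a\<close> or \<open>b\<close>, so no edge can be
      interleaved with this pair.\<close>
    then show "(a, b) \<in> parcs G"
      using crossed[OF a(1) b(1)] a(2) b(2) gr(2) by (fastforce simp: not_less[symmetric])
    fix i j v assume ij: "(i, j) \<in> parcs G" and v: "v \<in> pverts G" "f i < f v" "f v < f j"
    have V: "i \<in> pverts G" "j \<in> pverts G"
      using ij gr(2) by auto
    \<comment> \<open>The third vertex of the triangle on \<open>ij\<close> will be the last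
      neighbor of \<open>i\<close> before \<open>j\<close>.\<close>
    define K where "K = {k. (i, k) \<in> parcs G \<and> f i < f k \<and> f k < f j}"
    have "K \<noteq> {}"
    proof -
      define B where "B = {k \<in> pverts G. f i < f k \<and> f k < f j}"
      have "B \<noteq> {}"
        using v by (auto simp: B_def)
      then obtain k where k: "k \<in> B" "\<And>l. l \<in> B \<Longrightarrow> f k \<le> f l"
        using ex_has_least_nat[of "\<lambda>k. k \<in> B" _ f] by blast
      \<comment> \<open>Here \<open>k\<close> is the next vertex after \<open>i\<close>: an edge
        interleaved with \<open>ik\<close> would have an end strictly between them.\<close>
      have "(i, k) \<in> parcs G"
      proof (rule ccontr)
        assume "(i, k) \<notin> parcs G"
        then obtain x y where "(x, y) \<in> parcs G" "f i < f x" "f x < f k"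
          using crossed[OF V(1), of k] k(1) by (auto simp: B_def)
        then show False
          using k gr(2) by (force simp: B_def)
      qed
      then show ?thesis
        using k(1) by (auto simp: K_def B_def)
    qed
    moreover have "\<forall>k. k \<in> K \<longrightarrow> f k < f j"
      by (simp add: K_def)
    ultimately obtain k where k: "k \<in> K" "\<And>l. l \<in> K \<Longrightarrow> f l \<le> f k"
      using ex_has_greatest_nat[of "\<lambda>k. k \<in> K" _ f] by blast
    then have ik: "(i, k) \<in> parcs G" "f i < f k" "f k < f j"
      by (auto simp: K_def)
    have "(k, j) \<in> parcs G"
    proof (rule ccontr)
      assume "(k, j) \<notin> parcs G"
      then obtain x y where xy: "(x, y) \<in> parcs G" "f k < f x" "f x < f j" "f y < f k \<or> f j < f y"
        using crossed[OF _ V(2), of k] ik gr(2) by auto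
      have yx: "(y, x) \<in> parcs G"
        using sy xy(1) .
      \<comment> \<open>An edge \<open>xy\<close> interleaved with \<open>kj\<close> crosses
        \<open>ij\<close> if \<open>y\<close> is after \<open>j\<close> or before \<open>i\<close>,
        crosses \<open>ik\<close> if \<open>y\<close> is between \<open>i\<close> and
        \<open>k\<close>, and for \<open>y = i\<close> makes \<open>x\<close> a later neighbor of
        \<open>i\<close> than \<open>k\<close>.\<close>
      consider "f j < f y" | "f y < f i" | "f y = f i" | "f i < f y" "f y < f k"
        using xy(4) by linarith
      then show False
      proof cases
        case 1
        then show ?thesis
          using f(2) ij xy ik unfolding noncrossing_def by (meson less_trans)
      next
        case 2
        then show ?thesis
          using f(2) ij yx xy ik unfolding noncrossing_def by (meson less_trans)
      next
        case 3
        then have "y = i"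
          using inj_onD[OF f(1)] V(1) yx gr(2) by blast
        then have "x \<in> K"
          using yx xy ik by (auto simp: K_def)
        then show ?thesis
          using k(2) xy(2) by force
      next
        case 4
        then show ?thesis
          using f(2) ik(1) yx xy(2) unfolding noncrossing_def by blast
      qed
    qed
    then show "\<exists>k. f i < f k \<and> f k < f j \<and> (i, k) \<in> parcs G \<and> (k, j) \<in> parcs G"
      using ik by blast
  qed (use G f a b in auto)
  show ?thesis
    by (rule sudoku_number_2)
qed

theorem corollary3p13:
  shows "(\<forall>n\<ge>2. sudoku_number (with_proj (fan_graph n)) = 2) \<and>
    (\<forall>G :: 'a pair_pre_digraph.
       pair_graph G \<and> maximal_outerplanar G \<and> 3 \<le> card (pverts G) \<longrightarrow>
       sudoku_number (with_proj G) = 2)"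
  using sudoku_number_fan_graph sudoku_number_maximal_outerplanar by blast

end
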